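(* Let $F$ be a field and let $L=\{\alpha_1,\dotsc,\alpha_k\}\subset F$ be a set of $k\ge 1$ distinct elements with $0\notin L$. Then the following three statements are equivalent: (a) $N(r-1,L)>kr$ for some natural number $r\ge 1$; (b) there exists a primitive linear relation on $L$; (c) $N(r,L)=\Omega(r^{3/2})$. Furthermore, if $|L|\leq 3$, the exponent $3/2$ in (c) can be replaced by $5/3$ (that is, (a) and (b) are then equivalent to $N(r,L)=\Omega(r^{5/3})$). If $L\subset\mathbb{Z}$ (regarded as a subset of the field $\mathbb{Q}$) or $|L|=2$, the exponent $3/2$ in (c) can be replaced by $2$.
   Context: For a subset $L$ of a field $F$, an $L$-matrix is a square matrix over $F$ whose diagonal entries are all $0$ and each of whose off-diagonal entries belongs to $L$. $N(r,L)$ is the maximum $n$ such that there exists an $n\times n$ $L$-matrix of rank at most $r$. A primitive linear relation on $L=\{\alpha_1,\dotsc,\alpha_k\}$ is a tuple $(A_1,\dotsc,A_k)\in\mathbb{Z}^k$ with $A_1\alpha_1+\dotsb+A_k\alpha_k=0$ (in $F$) and $A_1+\dotsb+A_k=1$ (in $\mathbb{Z}$). The notation $N(r,L)=\Omega(r^{\gamma})$ means that there is a constant $c>0$ depending on $L$ such that $N(r,L)\ge c r^{\gamma}$ for all sufficiently large $r$. *)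

theory Defs
  imports
    Complex_Main
    "HOL-Library.FuncSet"
    "HOL-Library.Landau_Symbols"
    "Jordan_Normal_Form.DL_Rank"
begin

definition L_matrix :: "'a::field set \<Rightarrow> nat \<Rightarrow> 'a mat \<Rightarrow> bool" where
  "L_matrix L n M \<longleftrightarrow> M \<in> carrier_mat n n \<and>
     (\<forall>i<n. \<forall>j<n. if i = j then M $$ (i, j) = 0 else M $$ (i, j) \<in> L)"

text \<open>In \<^term>\<open>vec_space.rank n M\<close> the parameter \<^term>\<open>n\<close> is the number of rows.\<close>

definition L_sizes :: "nat \<Rightarrow> 'a::field set \<Rightarrow> nat set" where
  "L_sizes r L = {n. \<exists>M. L_matrix L n M \<and> vec_space.rank n M \<le> r}"

text \<open>The maximum is meaningful for finite \<^term>\<open>L\<close> not containing \<^term>\<open>0\<close>, because then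
  \<^term>\<open>L_sizes r L\<close> is finite and nonempty (lemmas \<open>finite_L_sizes\<close> and
  \<open>one_in_L_sizes\<close> below).\<close>

definition N :: "nat \<Rightarrow> 'a::field set \<Rightarrow> nat" where
  "N r L = Max (L_sizes r L)"

text \<open>A tuple of integers indexed by the elements of \<^term>\<open>L\<close> is a function, of which only the
  values on \<^term>\<open>L\<close> matter.\<close>

definition primitive_relation :: "'a::field set \<Rightarrow> ('a \<Rightarrow> int) \<Rightarrow> bool" where
  "primitive_relation L A \<longleftrightarrow>
     (\<Sum>\<alpha>\<in>L. of_int (A \<alpha>) * \<alpha>) = 0 \<and> (\<Sum>\<alpha>\<in>L. A \<alpha>) = 1"

lemma one_in_L_sizes: "1 \<in> L_sizes r (L :: 'a::field set)"
proof -
  have "L_matrix L 1 (0\<^sub>m 1 1)"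
    by (auto simp: L_matrix_def)
  moreover have "vec_space.rank 1 (0\<^sub>m 1 1 :: 'a mat) = 0"
    by (rule vec_space.rank_0I)
  ultimately show ?thesis
    unfolding L_sizes_def by (metis (mono_tags, lifting) le0 mem_Collect_eq)
qed

lemma L_matrix_size_bound:
  fixes L :: "'a::field set"
  assumes L: "finite L" "0 \<notin> L" and M: "L_matrix L n M" "vec_space.rank n M \<le> r"
  shows "n \<le> (card L + 1) ^ r"
proof -
  interpret vec_space "TYPE('a)" n .
  have carr: "M \<in> carrier_mat n n"
    using M(1) by (simp add: L_matrix_def)
  let ?P = "\<lambda>T. T \<subseteq> set (cols M) \<and> lin_indpt T"
  have cols: "set (cols M) \<subseteq> carrier_vec n"
    using carr cols_dim by blast
  obtain S where S: "finite S" "maximal S ?P"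
    using maximal_exists_superset[of "set (cols M)" ?P "{}"] by (auto simp: lindep_span lin_dep_def)
  then have Ssub: "S \<subseteq> set (cols M)"
    by (auto simp: maximal_def)
  have cardS: "card S \<le> r"
    using rank_card_indpt[OF carr S(2)] M(2) by simp
  have span: "set (cols M) \<subseteq> span S"
  proof
    fix v assume v: "v \<in> set (cols M)"
    show "v \<in> span S"
    proof (rule ccontr)
      assume nv: "v \<notin> span S"
      then have "lin_indpt (insert v S)"
        using lin_dep_iff_in_span[of S v] S Ssub cols v in_own_span[of S]
        by (auto simp: maximal_def)
      then have "insert v S = S"
        using S(2) v Ssub unfolding maximal_def by blast
      then show False
        using nv in_own_span[of S] Ssub cols by auto
    qed
  qed
  define f where "f = (\<lambda>i. restrict (\<lambda>v::'a vec. v $ i) S)"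
  have entry: "col M j $ i = M $$ (i, j)" if "i < n" "j < n" for i j
    using that carr by auto
  have ent_L: "M $$ (i, j) \<in> insert 0 L" if "i < n" "j < n" for i j
    using that M(1) by (auto simp: L_matrix_def split: if_splits)
  have "inj_on f {..<n}"
  proof (rule inj_onI)
    fix i j assume ij: "i \<in> {..<n}" "j \<in> {..<n}" "f i = f j"
    have agree: "v $ i = v $ j" if "v \<in> S" for v
      using fun_cong[OF ij(3), of v] that by (simp add: f_def)
    have "col M j \<in> span S"
      using span ij carr by (auto simp: cols_def)
    then obtain a where a: "col M j = lincomb a S"
      using finite_in_span[OF S(1)] Ssub cols by (metis module_vec_simps(3) subset_trans)
    have "lincomb a S $ i = lincomb a S $ j"
      using ij agree Ssub cols by (simp add: lincomb_index subset_trans)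
    then have "M $$ (i, j) = M $$ (j, j)"
      using entry[of i j] entry[of j j] ij(1,2) unfolding a by simp
    then show "i = j"
      using ij M(1) L(2) by (auto simp: L_matrix_def split: if_splits) metis
  qed
  moreover have "f ` {..<n} \<subseteq> S \<rightarrow>\<^sub>E insert 0 L"
  proof -
    have "f i \<in> S \<rightarrow>\<^sub>E insert 0 L" if "i < n" for i
    proof -
      have "v $ i \<in> insert 0 L" if v: "v \<in> S" for v
      proof -
        obtain j where "j < n" "v = col M j"
          using v Ssub carr by (auto simp: cols_def)
        then show ?thesis
          using entry[of i j] ent_L[of i j] \<open>i < n\<close> by simp
      qed
      then show ?thesis by (auto simp: f_def)
    qed
    then show ?thesis by auto
  qed
  ultimately have "card {..<n} \<le> card (S \<rightarrow>\<^sub>E insert 0 L)"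
    by (rule card_inj_on_le) (use S(1) L(1) in \<open>auto intro: finite_PiE\<close>)
  also have "\<dots> = (card L + 1) ^ card S"
    using S(1) L by (simp add: card_PiE)
  also have "\<dots> \<le> (card L + 1) ^ r"
    using cardS by (simp add: power_increasing)
  finally show ?thesis by simp
qed

lemma finite_L_sizes:
  assumes "finite L" "0 \<notin> L"
  shows "finite (L_sizes r (L :: 'a::field set))"
proof (rule finite_subset)
  show "L_sizes r L \<subseteq> {..(card L + 1) ^ r}"
    using L_matrix_size_bound[OF assms] by (auto simp: L_sizes_def)
qed simp

end

theory Submission
  imports
    Defs
    "HOL-Library.Product_Plus"
begin

text \<open>If an \<open>L\<close>-matrix of rank at most \<open>r - 1\<close> has more than \<open>k r\<close> rows, then there are coprime
  integers \<open>c\<^sub>i\<close> of sum zero such that, in each of \<open>r - 1\<close> columns spanning the column space, the \<open>c\<^sub>i\<close>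
  at the occurrences of every single element of \<open>L\<close> add up to zero. So \<open>c\<close> annihilates every column,
  and sorting the entries of column \<open>j\<close> by value gives an integer relation on \<open>L\<close> whose
  coefficients have sum \<open>- c\<^sub>j\<close>. The \<open>c\<^sub>j\<close> being coprime, some combination is a primitive relation.

  Conversely, fix \<open>\<alpha> \<in> L\<close> and write a primitive relation as
  \<open>\<alpha> + \<Sum>\<^sub>\<beta> A\<^sub>\<beta> (\<beta> - \<alpha>) = 0\<close>. Index the rows and columns by the points of the box \<open>[s]\<^sup>d\<close> and let the
  entry at \<open>(x, y)\<close> be \<open>\<alpha> + \<Sum>\<^sub>\<beta> F\<^sub>\<beta>(x - y) (\<beta> - \<alpha>)\<close>, where \<open>F\<^sub>\<beta>\<close> is a signed sum of indicator
  functions of subspaces of codimension at most \<open>e\<close>. Each indicator contributes rank \<open>O(s\<^sup>e)\<close>, so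
  the matrix shows \<open>N(r, L) = \<Omega>(r\<^bsup>d/e\<^esup>)\<close> as soon as \<open>F\<^sub>\<beta>(0) = A\<^sub>\<beta>\<close>, and off \<open>0\<close> the \<open>F\<^sub>\<beta>\<close> are
  indicators of disjoint sets. A nonnegative \<open>A\<^sub>\<beta>\<close> is produced by that many subspaces meeting only
  in \<open>0\<close>; a negative one by a larger subspace from which \<open>1 - A\<^sub>\<beta>\<close> such subspaces are removed.\<close>

subsection \<open>Large matrices yield primitive relations\<close>

text \<open>Gaussian elimination by induction on the equations, with cross-multiplication in place
  of division so that everything stays integral.\<close>

lemma homogeneous_system_int_solution:
  fixes a :: "'e \<Rightarrow> 'i \<Rightarrow> int"
  assumes "finite E" "finite I" "card E < card I"
  shows "\<exists>c. (\<exists>i\<in>I. c i \<noteq> 0) \<and> (\<forall>e\<in>E. (\<Sum>i\<in>I. a e i * c i) = 0)"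
  using assms
proof (induction E arbitrary: I a rule: finite_induct)
  case empty
  then obtain i where "i \<in> I" by fastforce
  then show ?case by (intro exI[of _ "\<lambda>_. 1"]) auto
next
  case (insert x E)
  show ?case
  proof (cases "\<forall>i\<in>I. a x i = 0")
    case True
    obtain c where "\<exists>i\<in>I. c i \<noteq> 0" "\<forall>e\<in>E. (\<Sum>i\<in>I. a e i * c i) = 0"
      using insert.IH[of I a] insert.prems insert.hyps by auto
    then show ?thesis using True by (intro exI[of _ c]) auto
  next
    case False
    then obtain k where k: "k \<in> I" "a x k \<noteq> 0" by blast
    define a' where "a' e i = a x k * a e i - a e k * a x i" for e i
    have "card E < card (I - {k})"
      using insert.prems insert.hyps k by simp
    then obtain c where c: "\<exists>i\<in>I - {k}. c i \<noteq> 0" "\<forall>e\<in>E. (\<Sum>i\<in>I - {k}. a' e i * c i) = 0"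
      using insert.IH[of "I - {k}" a'] insert.prems by auto
    \<comment> \<open>Scaling by the pivot \<open>a x k\<close> keeps \<open>c'\<close> integral and
      nonzero, while the value at \<open>k\<close> is chosen to solve equation
      \<open>x\<close>.\<close>
    define c' where "c' = (\<lambda>i. a x k * c i)(k := - (\<Sum>i\<in>I - {k}. a x i * c i))"
    have sum_c': "(\<Sum>i\<in>I. a e i * c' i) = (\<Sum>i\<in>I - {k}. a' e i * c i)" for e
    proof -
      have "(\<Sum>i\<in>I. a e i * c' i) = a e k * c' k + (\<Sum>i\<in>I - {k}. a e i * c' i)"
        using k insert.prems by (simp add: sum.remove)
      also have "(\<Sum>i\<in>I - {k}. a e i * c' i) = (\<Sum>i\<in>I - {k}. a x k * a e i * c i)"
        by (intro sum.cong) (auto simp: c'_def)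
      also have "a e k * c' k = - (\<Sum>i\<in>I - {k}. a e k * a x i * c i)"
        by (simp add: c'_def sum_distrib_left mult.assoc)
      finally show ?thesis
        by (simp add: a'_def left_diff_distrib sum_subtractf)
    qed
    have "(\<Sum>i\<in>I. a e i * c' i) = 0" if "e \<in> insert x E" for e
      using that c(2) by (auto simp: sum_c') (simp add: a'_def)
    moreover have "\<exists>i\<in>I. c' i \<noteq> 0"
      using c(1) k by (auto simp: c'_def)
    ultimately show ?thesis by blast
  qed
qed

text \<open>Divide a nonzero solution by the gcd of its values. Coprimality is what later yields a
  coefficient sum of exactly 1.\<close>

lemma homogeneous_system_coprime_solution:
  fixes a :: "'e \<Rightarrow> 'i \<Rightarrow> int"
  assumes "finite E" "finite I" "card E < card I"
  shows "\<exists>c. Gcd (c ` I) = 1 \<and> (\<forall>e\<in>E. (\<Sum>i\<in>I. a e i * c i) = 0)"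
proof -
  obtain c where c: "\<exists>i\<in>I. c i \<noteq> 0" "\<forall>e\<in>E. (\<Sum>i\<in>I. a e i * c i) = 0"
    using homogeneous_system_int_solution[OF assms, of a] by auto
  define g where "g = Gcd (c ` I)"
  have g: "g \<noteq> 0" "g \<ge> 0" using c(1) by (auto simp: g_def Gcd_0_iff)
  define c' where "c' i = c i div g" for i
  have c': "c i = g * c' i" if "i \<in> I" for i
    using that by (simp add: c'_def g_def)
  have "c ` I = (*) g ` (c' ` I)"
    using c' by (force simp: image_image)
  then have "g = normalize (g * Gcd (c' ` I))"
    unfolding Gcd_mult[symmetric] by (simp add: g_def)
  then have "Gcd (c' ` I) = 1"
    using g by (simp add: abs_mult)
  moreover have "(\<Sum>i\<in>I. a e i * c' i) = 0" if "e \<in> E" for e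
  proof -
    have "g * (\<Sum>i\<in>I. a e i * c' i) = (\<Sum>i\<in>I. a e i * c i)"
      unfolding sum_distrib_left using c' by (intro sum.cong) auto
    then show ?thesis using c(2) that g by simp
  qed
  ultimately show ?thesis by blast
qed

text \<open>Bezout, applied to one element of \<open>S\<close> at a time.\<close>

lemma Gcd_mem_subgroup:
  fixes J :: "int set"
  assumes "finite S" "S \<subseteq> J" "0 \<in> J"
    and add: "\<And>x y. x \<in> J \<Longrightarrow> y \<in> J \<Longrightarrow> x + y \<in> J"
    and mult: "\<And>x m. x \<in> J \<Longrightarrow> m * x \<in> J"
  shows "Gcd S \<in> J"
  using assms(1,2)
proof (induction S rule: finite_induct)
  case (insert x S)
  obtain u v where "u * x + v * Gcd S = gcd x (Gcd S)"
    using bezout_int by blast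
  then show ?case
    using insert add mult by (metis Gcd_insert insert_subset)
qed (use \<open>0 \<in> J\<close> in simp)

section \<open>Relations read off from a matrix of small rank\<close>

text \<open>An ideal of the integers, so a primitive relation is found by exhibiting members with
  gcd 1.\<close>

definition relation_sums :: "'a::field set \<Rightarrow> int set" where
  "relation_sums L = {\<Sum>\<alpha>\<in>L. A \<alpha> | A. (\<Sum>\<alpha>\<in>L. of_int (A \<alpha>) * \<alpha>) = 0}"

lemma one_in_relation_sums_iff: "1 \<in> relation_sums L \<longleftrightarrow> (\<exists>A. primitive_relation L A)"
  by (force simp: relation_sums_def primitive_relation_def)

lemma Gcd_in_relation_sums:
  assumes "finite S" "S \<subseteq> relation_sums L"
  shows "Gcd S \<in> relation_sums L"
proof (rule Gcd_mem_subgroup[OF assms])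
  show "0 \<in> relation_sums L"
    unfolding relation_sums_def by (intro CollectI exI[of _ "\<lambda>_. 0"]) simp
next
  fix x y assume "x \<in> relation_sums L" "y \<in> relation_sums L"
  then obtain A B where "x = (\<Sum>\<alpha>\<in>L. A \<alpha>)" "y = (\<Sum>\<alpha>\<in>L. B \<alpha>)"
    "(\<Sum>\<alpha>\<in>L. of_int (A \<alpha>) * \<alpha>) = 0" "(\<Sum>\<alpha>\<in>L. of_int (B \<alpha>) * \<alpha>) = 0"
    unfolding relation_sums_def by auto
  then show "x + y \<in> relation_sums L"
    unfolding relation_sums_def
    by (intro CollectI exI[of _ "\<lambda>\<alpha>. A \<alpha> + B \<alpha>"]) (simp add: sum.distrib distrib_right)
next
  fix x m assume "x \<in> relation_sums L"
  then obtain A where "x = (\<Sum>\<alpha>\<in>L. A \<alpha>)" "(\<Sum>\<alpha>\<in>L. of_int (A \<alpha>) * \<alpha>) = 0"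
    unfolding relation_sums_def by auto
  then show "m * x \<in> relation_sums L"
    unfolding relation_sums_def
    by (intro CollectI exI[of _ "\<lambda>\<alpha>. m * A \<alpha>"])
      (simp add: sum_distrib_left[symmetric] mult.assoc)
qed

text \<open>Indices are grouped by the value of \<open>x\<close>, the value 0 contributing nothing.
  This serves both to make \<open>c\<close> annihilate the generating columns and to turn an
  annihilated column into a relation on \<open>L\<close>.\<close>

lemma sum_by_value:
  fixes x :: "'i \<Rightarrow> 'a::field" and c :: "'i \<Rightarrow> int"
  assumes "finite L" "finite I" "\<And>i. i \<in> I \<Longrightarrow> x i \<in> insert 0 L"
  shows "(\<Sum>i\<in>I. of_int (c i) * x i) = (\<Sum>\<alpha>\<in>L. of_int (\<Sum>i\<in>I. of_bool (x i = \<alpha>) * c i) * \<alpha>)"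
proof -
  have "(\<Sum>\<alpha>\<in>L. of_int (\<Sum>i\<in>I. of_bool (x i = \<alpha>) * c i) * \<alpha>) =
      (\<Sum>i\<in>I. \<Sum>\<alpha>\<in>L. of_int (of_bool (x i = \<alpha>) * c i) * \<alpha>)"
    by (subst sum.swap) (simp add: sum_distrib_right)
  also have "\<dots> = (\<Sum>i\<in>I. of_int (c i) * x i)"
  proof (intro sum.cong refl)
    fix i assume "i \<in> I"
    have "(\<Sum>\<alpha>\<in>L. of_int (of_bool (x i = \<alpha>) * c i) * \<alpha>) = (\<Sum>\<alpha>\<in>L. if x i = \<alpha> then of_int (c i) * x i else 0)"
      by (intro sum.cong) auto
    also have "\<dots> = of_int (c i) * x i"
      using assms(1) assms(3)[OF \<open>i \<in> I\<close>] by (auto simp: sum.delta)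
    finally show "(\<Sum>\<alpha>\<in>L. of_int (of_bool (x i = \<alpha>) * c i) * \<alpha>) = of_int (c i) * x i" .
  qed
  finally show ?thesis ..
qed

text \<open>A maximal independent set of columns spans all of them. Generators that are themselves
  columns have entries in \<open>insert 0 L\<close> when \<open>M\<close> is an
  \<open>L\<close>-matrix.\<close>

lemma columns_generated_by_few:
  fixes M :: "'a::field mat"
  assumes M: "M \<in> carrier_mat n n"
  obtains S where "S \<subseteq> set (cols M)" "finite S" "card S = vec_space.rank n M"
    "\<And>j. j < n \<Longrightarrow> \<exists>a. \<forall>i<n. M $$ (i, j) = (\<Sum>v\<in>S. a v * v $ i)"
proof -
  interpret vec_space "TYPE('a)" n .
  let ?P = "\<lambda>T. T \<subseteq> set (cols M) \<and> lin_indpt T"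
  have cols: "set (cols M) \<subseteq> carrier_vec n"
    using M cols_dim by blast
  obtain S where S: "finite S" "maximal S ?P"
    using maximal_exists_superset[of "set (cols M)" ?P "{}"] by (auto simp: lindep_span lin_dep_def)
  then have Ssub: "S \<subseteq> set (cols M)"
    by (auto simp: maximal_def)
  have span: "v \<in> span S" if v: "v \<in> set (cols M)" for v
  proof (rule ccontr)
    assume nv: "v \<notin> span S"
    then have "lin_indpt (insert v S)"
      using lin_dep_iff_in_span[of S v] S Ssub cols v in_own_span[of S]
      by (auto simp: maximal_def)
    then have "insert v S = S"
      using S(2) v Ssub unfolding maximal_def by blast
    then show False
      using nv in_own_span[of S] Ssub cols by auto
  qed
  have "\<exists>a. \<forall>i<n. M $$ (i, j) = (\<Sum>v\<in>S. a v * v $ i)" if j: "j < n" for j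
  proof -
    have "col M j \<in> span S"
      using span j M by (auto simp: cols_def)
    then obtain a where a: "col M j = lincomb a S"
      using finite_in_span[OF S(1)] Ssub cols by (metis module_vec_simps(3) subset_trans)
    have "M $$ (i, j) = (\<Sum>v\<in>S. a v * v $ i)" if "i < n" for i
      using a lincomb_index[OF that, of S a] Ssub cols M that j by (auto dest!: arg_cong[where f = "\<lambda>v. v $ i"])
    then show ?thesis by blast
  qed
  then show ?thesis
    using that[OF Ssub S(1)] rank_card_indpt[OF M S(2)] by auto
qed

proposition primitive_relation_of_large_L_matrix:
  fixes L :: "'a::field set"
  assumes L: "finite L" "0 \<notin> L" and M: "L_matrix L n M"
    and large: "card L * vec_space.rank n M + 1 < n"
  shows "\<exists>A. primitive_relation L A"
proof -
  have carr: "M \<in> carrier_mat n n"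
    using M by (simp add: L_matrix_def)
  obtain S where S: "S \<subseteq> set (cols M)" "finite S" "card S = vec_space.rank n M"
    and gen: "\<And>j. j < n \<Longrightarrow> \<exists>a. \<forall>i<n. M $$ (i, j) = (\<Sum>v\<in>S. a v * v $ i)"
    using columns_generated_by_few[OF carr] by metis
  have ent: "M $$ (i, j) \<in> insert 0 L" "M $$ (i, j) \<noteq> 0 \<longleftrightarrow> i \<noteq> j" if "i < n" "j < n" for i j
    using that M L(2) unfolding L_matrix_def by (metis insert_iff)+
  have entS: "v $ i \<in> insert 0 L" if "v \<in> S" "i < n" for v i
    using that S(1) carr ent(1) by (auto simp: cols_def) fastforce
  \<comment> \<open>\<open>None\<close> stands for the equation that the \<open>c i\<close> add up
    to 0, and \<open>Some (v, \<alpha>)\<close> for the same over the positions where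
    \<open>v\<close> has the entry \<open>\<alpha>\<close>. There are fewer equations than the
    \<open>n\<close> unknowns.\<close>
  define E where "E = insert None (Some ` (S \<times> L))"
  define a :: "('a vec \<times> 'a) option \<Rightarrow> nat \<Rightarrow> int"
    where "a = case_option (\<lambda>_. 1) (\<lambda>(v, \<alpha>) i. of_bool (v $ i = \<alpha>))"
  have "card E = card L * vec_space.rank n M + 1"
    using S L by (simp add: E_def card_image card_cartesian_product)
  moreover have "finite E"
    using S L by (simp add: E_def)
  ultimately obtain c where c: "Gcd (c ` {..<n}) = 1" "\<forall>e\<in>E. (\<Sum>i<n. a e i * c i) = 0"
    using homogeneous_system_coprime_solution[of E "{..<n}" a] large by auto
  have sum0: "(\<Sum>i<n. c i) = 0"
    using c(2) by (simp add: E_def a_def)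
  have Sorth: "(\<Sum>i<n. of_int (c i) * v $ i) = 0" if v: "v \<in> S" for v
  proof -
    have "(\<Sum>i<n. of_bool (v $ i = \<alpha>) * c i) = 0" if "\<alpha> \<in> L" for \<alpha>
      using c(2) v that by (simp add: E_def a_def)
    then show ?thesis
      using sum_by_value[of L "{..<n}" "\<lambda>i. v $ i" c] L entS[OF v] by simp
  qed
  \<comment> \<open>Column \<open>j\<close> has an entry of \<open>L\<close> everywhere except at
    position \<open>j\<close>, so its coefficients by value add up to the total 0 of
    \<open>c\<close> minus \<open>c j\<close>.\<close>
  have "- c j \<in> relation_sums L" if j: "j < n" for j
  proof -
    obtain b where b: "\<forall>i<n. M $$ (i, j) = (\<Sum>v\<in>S. b v * v $ i)"
      using gen[OF j] by blast
    have "(\<Sum>i<n. of_int (c i) * M $$ (i, j)) = (\<Sum>i<n. \<Sum>v\<in>S. b v * (of_int (c i) * v $ i))"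
      using b by (intro sum.cong) (auto simp: sum_distrib_left mult_ac)
    also have "\<dots> = (\<Sum>v\<in>S. b v * (\<Sum>i<n. of_int (c i) * v $ i))"
      by (subst sum.swap) (simp add: sum_distrib_left)
    finally have "(\<Sum>i<n. of_int (c i) * M $$ (i, j)) = 0"
      using Sorth by simp
    then have "(\<Sum>\<alpha>\<in>L. of_int (\<Sum>i<n. of_bool (M $$ (i, j) = \<alpha>) * c i) * \<alpha>) = 0"
      using sum_by_value[of L "{..<n}" "\<lambda>i. M $$ (i, j)" c] L ent(1) j by simp
    moreover have "(\<Sum>\<alpha>\<in>L. \<Sum>i<n. of_bool (M $$ (i, j) = \<alpha>) * c i) = - c j"
    proof -
      have "(\<Sum>\<alpha>\<in>L. \<Sum>i<n. of_bool (M $$ (i, j) = \<alpha>) * c i) = (\<Sum>i<n. \<Sum>\<alpha>\<in>L. of_bool (M $$ (i, j) = \<alpha>) * c i)"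
        by (rule sum.swap)
      also have "\<dots> = (\<Sum>i<n. if i = j then 0 else c i)"
      proof (intro sum.cong refl)
        fix i assume "i \<in> {..<n}"
        have "(\<Sum>\<alpha>\<in>L. of_bool (M $$ (i, j) = \<alpha>) * c i) = (\<Sum>\<alpha>\<in>L. if M $$ (i, j) = \<alpha> then c i else 0)"
          by (intro sum.cong) auto
        then show "(\<Sum>\<alpha>\<in>L. of_bool (M $$ (i, j) = \<alpha>) * c i) = (if i = j then 0 else c i)"
          using ent[of i j] \<open>i \<in> {..<n}\<close> j L by (auto simp: sum.delta)
      qed
      also have "\<dots> = (\<Sum>i<n. c i) - c j"
        using j by (simp add: sum.remove[of "{..<n}" j])
      finally show ?thesis using sum0 by simp
    qed
    ultimately show ?thesis
      unfolding relation_sums_def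
      by (intro CollectI exI[of _ "\<lambda>\<alpha>. \<Sum>i<n. of_bool (M $$ (i, j) = \<alpha>) * c i"]) simp
  qed
  then have "Gcd ((\<lambda>j. - c j) ` {..<n}) \<in> relation_sums L"
    by (intro Gcd_in_relation_sums) auto
  moreover have "Gcd ((\<lambda>j. - c j) ` {..<n}) = Gcd (c ` {..<n})"
    using Gcd_mult[of "-1" "c ` {..<n}"] by (simp add: image_image)
  ultimately show ?thesis
    using c(1) one_in_relation_sums_iff by metis
qed

lemma primitive_relation_of_N:
  fixes L :: "'a::field set"
  assumes L: "finite L" "card L \<ge> 1" "0 \<notin> L" and r: "r \<ge> 1" "N (r - 1) L > card L * r"
  shows "\<exists>A. primitive_relation L A"
proof -
  have "N (r - 1) L \<in> L_sizes (r - 1) L"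
    unfolding N_def using finite_L_sizes L(1,3) one_in_L_sizes by (metis Max_in empty_iff)
  then obtain M where M: "L_matrix L (N (r - 1) L) M" "vec_space.rank (N (r - 1) L) M \<le> r - 1"
    unfolding L_sizes_def by auto
  \<comment> \<open>The extra equation costs 1, which \<open>card L \<ge> 1\<close> pays for in the
    step from \<open>r - 1\<close> to \<open>r\<close>.\<close>
  have "card L * vec_space.rank (N (r - 1) L) M + 1 \<le> card L * (r - 1) + card L"
    using M(2) L(2) by (intro add_mono mult_le_mono) auto
  also have "\<dots> = card L * r"
    using r(1) by (simp add: algebra_simps)
  finally show ?thesis
    using r(2) by (intro primitive_relation_of_large_L_matrix[OF L(1,3) M(1)]) simp
qed

text \<open>A power with exponent above 1 outgrows every linear function.\<close>

lemma large_N_of_bigomega: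
  fixes L :: "'a::field set"
  assumes "(\<lambda>r. real (N r L)) \<in> \<Omega>(\<lambda>r. real r powr p)" "p > 1"
  shows "\<exists>r\<ge>1. N (r - 1) L > card L * r"
proof -
  obtain c where c: "c > 0" "\<forall>\<^sub>F r in sequentially. norm (real (N r L)) \<ge> c * norm (real r powr p)"
    using assms(1) by (elim landau_omega.bigE)
  \<comment> \<open>For \<open>r \<ge> 1\<close> the target \<open>card L * (r + 1)\<close> is below
    \<open>K * r\<close>, and \<open>x\<close> is where \<open>c * x powr (p - 1)\<close> reaches
    \<open>K\<close>.\<close>
  define K where "K = real (2 * card L + 1)"
  define x where "x = (K / c) powr (1 / (p - 1))"
  have "K \<le> c * real r powr (p - 1)" if "r \<ge> nat \<lceil>x\<rceil>" for r
  proof -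
    have "x \<le> real r" using that by linarith
    then have "x powr (p - 1) \<le> real r powr (p - 1)"
      using assms(2) by (intro powr_mono2) (auto simp: x_def)
    moreover have "x powr (p - 1) = K / c"
      using c(1) assms(2) by (simp add: x_def powr_powr K_def)
    ultimately show ?thesis using c(1) by (simp add: field_simps)
  qed
  then have "\<forall>\<^sub>F r::nat in sequentially. real (2 * card L + 1) \<le> c * real r powr (p - 1)"
    unfolding K_def by (intro eventually_sequentiallyI)
  with c(2) eventually_ge_at_top[of 1]
  have "\<forall>\<^sub>F r in sequentially. card L * (r + 1) < N r L"
  proof eventually_elim
    case (elim r)
    have "real (card L * (r + 1)) < real (2 * card L + 1) * real r"
    proof -
      have "card L * (r + 1) \<le> card L * (2 * r)"
        using elim(2) by (intro mult_le_mono) auto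
      also have "\<dots> < (2 * card L + 1) * r" using elim(2) by (simp add: algebra_simps)
      finally have "card L * (r + 1) < (2 * card L + 1) * r" .
      then show ?thesis by (metis of_nat_less_iff of_nat_mult)
    qed
    also have "\<dots> \<le> c * real r powr (p - 1) * real r"
      using elim(3) by (intro mult_right_mono) auto
    also have "\<dots> = c * real r powr p"
      using elim(2) by (simp add: powr_diff)
    also have "\<dots> \<le> real (N r L)"
      using elim(1) by simp
    finally show ?case by (simp only: of_nat_less_iff)
  qed
  then obtain r where "card L * (r + 1) < N r L"
    by (auto simp: eventually_sequentially)
  then show ?thesis by (intro exI[of _ "r + 1"]) auto
qed

subsection \<open>Matrices built from primitive relations\<close>

lemma rank_sum_products_le:
  fixes f g :: "'q \<Rightarrow> nat \<Rightarrow> 'a::field"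
  assumes "finite Q"
  shows "vec_space.rank n (mat n nc (\<lambda>(i, j). \<Sum>q\<in>Q. f q i * g q j)) \<le> card Q"
  using assms
proof (induction Q rule: finite_induct)
  case empty
  have "mat n nc (\<lambda>(i, j). \<Sum>q\<in>{}. f q i * g q j) = 0\<^sub>m n nc"
    by (intro eq_matI) auto
  then show ?case
    by (simp only: vec_space.rank_0I card.empty)
next
  case (insert x Q)
  let ?M = "\<lambda>Q. mat n nc (\<lambda>(i, j). \<Sum>q\<in>Q. f q i * g q j)"
  have "?M (insert x Q) = ?M {x} + ?M Q"
    using insert.hyps by (intro eq_matI) auto
  then have "vec_space.rank n (?M (insert x Q)) \<le> vec_space.rank n (?M {x}) + vec_space.rank n (?M Q)"
    using vec_space.rank_subadditive[of "?M {x}" n nc "?M Q"] by simp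
  moreover have "vec_space.rank n (?M {x}) \<le> 1"
    by (rule vec_space.rank_le_1_product_entries[of _ n nc "f x" "g x"]) auto
  ultimately show ?case
    using insert by simp
qed

text \<open>For each \<open>t\<close>, the 0/1 matrix recording equality of keys is a sum of one
  rank-one block per value of \<open>key t\<close>. The matrix is the combination of these with
  weights \<open>w t\<close>; on the diagonal all keys agree, so the entry is the total
  weight.\<close>

lemma card_mem_L_sizes:
  fixes L :: "'a::field set" and key :: "'t \<Rightarrow> 'p \<Rightarrow> 'q"
  assumes "finite X" "finite T"
    and offdiag: "\<And>x y. x \<in> X \<Longrightarrow> y \<in> X \<Longrightarrow> x \<noteq> y \<Longrightarrow>
      (\<Sum>t\<in>T. if key t x = key t y then w t else 0) \<in> L"
    and diag: "(\<Sum>t\<in>T. w t) = 0"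
  shows "card X \<in> L_sizes (\<Sum>t\<in>T. card (key t ` X)) L"
proof -
  define n where "n = card X"
  obtain p where p: "bij_betw p {..<n} X"
    unfolding n_def using \<open>finite X\<close> ex_bij_betw_nat_finite lessThan_atLeast0 by metis
  have pX: "p i \<in> X" if "i < n" for i
    using p that by (auto simp: bij_betw_def)
  have pinj: "p i = p j \<longleftrightarrow> i = j" if "i < n" "j < n" for i j
    using p that by (auto simp: bij_betw_def inj_on_def)
  define Q where "Q = (SIGMA t:T. key t ` X)"
  define f where "f = (\<lambda>(t, z) i. if key t (p i) = z then w t else 0)"
  define g :: "'t \<times> 'q \<Rightarrow> nat \<Rightarrow> 'a" where "g = (\<lambda>(t, z) j. if key t (p j) = z then 1 else 0)"
  let ?M = "mat n n (\<lambda>(i, j). \<Sum>q\<in>Q. f q i * g q j)"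
  have entry: "(\<Sum>q\<in>Q. f q i * g q j) = (\<Sum>t\<in>T. if key t (p i) = key t (p j) then w t else 0)"
    if "i < n" "j < n" for i j
  proof -
    have "(\<Sum>q\<in>Q. f q i * g q j) = (\<Sum>t\<in>T. \<Sum>z\<in>key t ` X. f (t, z) i * g (t, z) j)"
      unfolding Q_def using assms(1,2) by (subst sum.Sigma) auto
    also have "\<dots> = (\<Sum>t\<in>T. \<Sum>z\<in>key t ` X. if z = key t (p i) then
        (if key t (p i) = key t (p j) then w t else 0) else 0)"
      by (intro sum.cong) (auto simp: f_def g_def)
    also have "\<dots> = (\<Sum>t\<in>T. if key t (p i) = key t (p j) then w t else 0)"
      using \<open>finite X\<close> pX[OF that(1)] by (intro sum.cong) (auto simp: sum.delta)
    finally show ?thesis .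
  qed
  have "vec_space.rank n ?M \<le> card Q"
    by (rule rank_sum_products_le) (use assms(1,2) in \<open>auto simp: Q_def\<close>)
  moreover have "card Q = (\<Sum>t\<in>T. card (key t ` X))"
    unfolding Q_def using assms(1,2) by (intro card_SigmaI) auto
  moreover have "L_matrix L n ?M"
    using entry offdiag pX pinj diag by (auto simp: L_matrix_def)
  ultimately show ?thesis
    unfolding L_sizes_def n_def by auto
qed

text \<open>Since the coefficients add up to 1, subtracting \<open>\<alpha>\<close> from every
  element lowers the sum by \<open>\<alpha>\<close>; the term of \<open>\<alpha>\<close> itself
  becomes 0.\<close>

lemma sum_scaled_shift:
  fixes A :: "'a::field \<Rightarrow> int"
  assumes "finite L" "\<alpha> \<in> L" "(\<Sum>\<beta>\<in>L. A \<beta>) = 1"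
  shows "(\<Sum>\<beta>\<in>L. of_int (A \<beta>) * \<beta>) = \<alpha> + (\<Sum>\<beta>\<in>L - {\<alpha>}. of_int (A \<beta>) * (\<beta> - \<alpha>))"
proof -
  have "(\<Sum>\<beta>\<in>L. of_int (A \<beta>) * (\<beta> - \<alpha>)) =
      (\<Sum>\<beta>\<in>L. of_int (A \<beta>) * \<beta>) - of_int (\<Sum>\<beta>\<in>L. A \<beta>) * \<alpha>"
    by (simp add: right_diff_distrib sum_subtractf sum_distrib_right)
  then show ?thesis
    using assms by (simp add: sum.remove)
qed

lemma primitive_relation_shift:
  assumes "finite L" "primitive_relation L A" "\<alpha> \<in> L"
  shows "\<alpha> + (\<Sum>\<beta>\<in>L - {\<alpha>}. of_int (A \<beta>) * (\<beta> - \<alpha>)) = (0 :: 'a::field)"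
  using sum_scaled_shift[of L \<alpha> A] assms by (simp add: primitive_relation_def)

text \<open>The weights count multiples of \<open>\<beta> - \<alpha>\<close> on top of a constant
  \<open>\<alpha>\<close>. The entry at \<open>(x, y)\<close> is then \<open>\<gamma>\<close>, where
  \<open>\<gamma> = \<alpha>\<close> means that all counts vanish.\<close>

lemma card_mem_L_sizes_of_relation:
  fixes L :: "'a::field set" and key :: "'t \<Rightarrow> 'p \<Rightarrow> 'q" and \<epsilon> :: "'a \<Rightarrow> 't \<Rightarrow> int"
  assumes "finite L" "primitive_relation L A" "\<alpha> \<in> L" "finite X" "finite T"
    and diag: "\<And>\<beta>. \<beta> \<in> L - {\<alpha>} \<Longrightarrow> (\<Sum>t\<in>T. \<epsilon> \<beta> t) = A \<beta>"
    and offdiag: "\<And>x y. x \<in> X \<Longrightarrow> y \<in> X \<Longrightarrow> x \<noteq> y \<Longrightarrow> \<exists>\<gamma>\<in>L. \<forall>\<beta>\<in>L - {\<alpha>}.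
      (\<Sum>t\<in>T. if key t x = key t y then \<epsilon> \<beta> t else 0) = of_bool (\<beta> = \<gamma>)"
  shows "card X \<in> L_sizes (1 + (\<Sum>t\<in>T. card (key t ` X))) L"
proof (cases "X = {}")
  case True
  have "L_matrix L 0 (0\<^sub>m 0 0)" "vec_space.rank 0 (0\<^sub>m 0 0 :: 'a mat) = 0"
    by (auto simp: L_matrix_def vec_space.rank_0I)
  then show ?thesis
    using True unfolding L_sizes_def by force
next
  case False
  let ?T = "insert None (Some ` T)"
  \<comment> \<open>\<open>None\<close> carries the constant summand \<open>\<alpha>\<close>; its
    key has a single value on a nonempty \<open>X\<close>, hence the 1 in the rank bound.\<close>
  define w where "w = case_option \<alpha> (\<lambda>t. \<Sum>\<beta>\<in>L - {\<alpha>}. of_int (\<epsilon> \<beta> t) * (\<beta> - \<alpha>))"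
  define key' where "key' = case_option (\<lambda>_. undefined) key"
  have "card X \<in> L_sizes (\<Sum>t\<in>?T. card (key' t ` X)) L"
  proof (rule card_mem_L_sizes[where w = w])
    have "(\<Sum>t\<in>?T. w t) = \<alpha> + (\<Sum>t\<in>T. \<Sum>\<beta>\<in>L - {\<alpha>}. of_int (\<epsilon> \<beta> t) * (\<beta> - \<alpha>))"
      using \<open>finite T\<close> by (simp add: w_def sum.reindex)
    also have "\<dots> = \<alpha> + (\<Sum>\<beta>\<in>L - {\<alpha>}. of_int (\<Sum>t\<in>T. \<epsilon> \<beta> t) * (\<beta> - \<alpha>))"
      by (subst sum.swap) (simp add: sum_distrib_right)
    also have "\<dots> = 0"
      using primitive_relation_shift[OF assms(1-3)] diag by simp
    finally show "(\<Sum>t\<in>?T. w t) = 0" .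
  next
    fix x y assume xy: "x \<in> X" "y \<in> X" "x \<noteq> y"
    then obtain \<gamma> where \<gamma>: "\<gamma> \<in> L" "\<And>\<beta>. \<beta> \<in> L - {\<alpha>} \<Longrightarrow>
        (\<Sum>t\<in>T. if key t x = key t y then \<epsilon> \<beta> t else 0) = of_bool (\<beta> = \<gamma>)"
      using offdiag by blast
    have "(\<Sum>t\<in>?T. if key' t x = key' t y then w t else 0) =
        \<alpha> + (\<Sum>t\<in>T. \<Sum>\<beta>\<in>L - {\<alpha>}. of_int (if key t x = key t y then \<epsilon> \<beta> t else 0) * (\<beta> - \<alpha>))"
      using \<open>finite T\<close> by (auto simp: w_def key'_def sum.reindex intro!: sum.cong)
    also have "\<dots> = \<alpha> + (\<Sum>\<beta>\<in>L - {\<alpha>}. of_int (\<Sum>t\<in>T. if key t x = key t y then \<epsilon> \<beta> t else 0) * (\<beta> - \<alpha>))"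
      by (subst sum.swap) (simp only: of_int_sum sum_distrib_right)
    also have "\<dots> = \<alpha> + (\<Sum>\<beta>\<in>L - {\<alpha>}. if \<beta> = \<gamma> then \<gamma> - \<alpha> else 0)"
      using \<gamma>(2) by (auto simp: of_bool_def intro!: sum.cong split: if_splits)
    also have "\<dots> = \<gamma>"
      using \<open>finite L\<close> \<gamma>(1) by (simp add: sum.delta)
    finally show "(\<Sum>t\<in>?T. if key' t x = key' t y then w t else 0) \<in> L"
      using \<gamma>(1) by simp
  qed (use assms in auto)
  moreover have "(\<Sum>t\<in>?T. card (key' t ` X)) = 1 + (\<Sum>t\<in>T. card (key t ` X))"
    using \<open>finite T\<close> False by (simp add: key'_def sum.reindex image_constant_conv)
  ultimately show ?thesis by simp
qed

lemma L_sizes_mono: "r \<le> s \<Longrightarrow> L_sizes r L \<subseteq> L_sizes s L"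
  by (auto simp: L_sizes_def)

section \<open>From sizes of boxes to growth rates\<close>

lemma N_bigomegaI:
  fixes L :: "'a::field set"
  assumes "finite L" "0 \<notin> L" "e \<ge> 1"
    and sizes: "\<And>s. s \<ge> 1 \<Longrightarrow> s ^ d \<in> L_sizes (C * s ^ e) L"
  shows "(\<lambda>r. real (N r L)) \<in> \<Omega>(\<lambda>r. real r powr (real d / real e))"
proof -
  \<comment> \<open>The maximum with 1 makes \<open>D\<close> a valid divisor.\<close>
  define D where "D = max C 1"
  define c where "c = (1 / real D) powr (real d / real e) / 2 ^ d"
  have D: "D \<ge> 1" "C \<le> D" by (auto simp: D_def)
  have c: "c > 0" using D by (simp add: c_def)
  have "c * real r powr (real d / real e) \<le> real (N r L)" if r: "r \<ge> D" for r
  proof -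
    \<comment> \<open>\<open>s\<close> is the largest integer with \<open>D * s ^ e \<le> r\<close>.
      Rounding \<open>x \<ge> 1\<close> down loses at most a factor 2, whence the
      \<open>2 ^ d\<close> in \<open>c\<close>.\<close>
    define x where "x = (real r / real D) powr (1 / real e)"
    define s where "s = nat \<lfloor>x\<rfloor>"
    have rD: "real r / real D \<ge> 1" using r D by (simp add: field_simps)
    then have x1: "x \<ge> 1" unfolding x_def by (simp add: ge_one_powr_ge_zero)
    have s1: "s \<ge> 1" using x1 by (simp add: s_def le_nat_floor)
    have sx: "real s \<le> x" using x1 by (simp add: s_def)
    have xs: "x / 2 \<le> real s"
    proof -
      have "x < real s + 1" using x1 unfolding s_def by linarith
      then show ?thesis using s1 by simp
    qed
    have pow: "x ^ m = (real r / real D) powr (real m / real e)" for m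
    proof -
      have "x ^ m = x powr real m" using x1 by (simp add: powr_realpow)
      then show ?thesis by (simp add: x_def powr_powr)
    qed
    have "real s ^ e \<le> x ^ e" using sx by (intro power_mono) auto
    also have "x ^ e = real r / real D"
      using rD \<open>e \<ge> 1\<close> by (simp add: pow)
    finally have "real D * real s ^ e \<le> real r" using D by (simp add: field_simps)
    then have "real (D * s ^ e) \<le> real r" by simp
    then have "D * s ^ e \<le> r" by linarith
    then have "C * s ^ e \<le> r" using D(2) by (meson le_trans mult_le_mono1)
    then have "s ^ d \<in> L_sizes r L" using sizes[OF s1] L_sizes_mono by blast
    then have "s ^ d \<le> N r L"
      unfolding N_def using finite_L_sizes[OF assms(1,2)] by (intro Max_ge)
    then have "real s ^ d \<le> real (N r L)" by (metis of_nat_le_iff of_nat_power)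
    moreover have "(x / 2) ^ d \<le> real s ^ d" using xs x1 by (intro power_mono) auto
    moreover have "(x / 2) ^ d = c * real r powr (real d / real e)"
    proof -
      have "x ^ d = (real r / real D) powr (real d / real e)"
        by (rule pow)
      also have "\<dots> = real r powr (real d / real e) * (1 / real D) powr (real d / real e)"
        using D by (simp add: powr_mult[symmetric])
      finally show ?thesis by (simp add: c_def power_divide)
    qed
    ultimately show ?thesis by linarith
  qed
  then show ?thesis
    using c by (intro landau_omega.bigI[of c] eventually_sequentiallyI[of D]) auto
qed

text \<open>Reduces each exponent to a configuration of subspaces: keys are lists of
  \<open>e\<close> integers of size \<open>O(s)\<close>, hence take \<open>O(s^e)\<close> values. In
  the applications two points share a key when their difference lies in the corresponding
  subspace.\<close>

proposition N_bigomega_of_relation: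
  fixes L :: "'a::field set" and key :: "'a \<Rightarrow> 't \<Rightarrow> 'p \<Rightarrow> int list" and \<epsilon> :: "'a \<Rightarrow> 't \<Rightarrow> int"
  assumes "finite L" "0 \<notin> L" "primitive_relation L A" "\<alpha> \<in> L" "e \<ge> 1"
    and U: "\<And>\<beta>. finite (U \<beta>)"
    and X: "\<And>s. finite (X s)" "\<And>s. card (X s) = s ^ d"
    and key: "\<And>s \<beta> t x. \<beta> \<in> L - {\<alpha>} \<Longrightarrow> t \<in> U \<beta> \<Longrightarrow> x \<in> X s \<Longrightarrow>
      length (key \<beta> t x) = e \<and> (\<forall>z\<in>set (key \<beta> t x). \<bar>z\<bar> \<le> B \<beta> t * int s)"
    and diag: "\<And>\<beta>. \<beta> \<in> L - {\<alpha>} \<Longrightarrow> (\<Sum>t\<in>U \<beta>. \<epsilon> \<beta> t) = A \<beta>"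
    and offdiag: "\<And>s x y. x \<in> X s \<Longrightarrow> y \<in> X s \<Longrightarrow> x \<noteq> y \<Longrightarrow> \<exists>\<gamma>\<in>L. \<forall>\<beta>\<in>L - {\<alpha>}.
      (\<Sum>t\<in>U \<beta>. if key \<beta> t x = key \<beta> t y then \<epsilon> \<beta> t else 0) = of_bool (\<beta> = \<gamma>)"
  shows "(\<lambda>r. real (N r L)) \<in> \<Omega>(\<lambda>r. real r powr (real d / real e))"
proof (rule N_bigomegaI)
  fix s :: nat assume s: "s \<ge> 1"
  define T where "T = (SIGMA \<beta>:L - {\<alpha>}. U \<beta>)"
  \<comment> \<open>As \<open>s \<ge> 1\<close>, an interval of radius
    \<open>\<bar>B \<beta> t\<bar> * s\<close> contains at most
    \<open>(2 * \<bar>B \<beta> t\<bar> + 1) * s\<close> integers.\<close>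
  define C where "C = (\<lambda>(\<beta>, t). nat (2 * \<bar>B \<beta> t\<bar> + 1) ^ e)"
  let ?key = "\<lambda>(\<beta>, t). key \<beta> t"
  let ?\<epsilon> = "\<lambda>\<gamma> (\<beta>, t). if \<beta> = \<gamma> then \<epsilon> \<beta> t else 0"
  have T: "finite T"
    using \<open>finite L\<close> U by (simp add: T_def)
  have sum_T: "(\<Sum>(\<beta>, t)\<in>T. if \<beta> = \<gamma> then f \<beta> t else 0) = (\<Sum>t\<in>U \<gamma>. f \<gamma> t)"
    if "\<gamma> \<in> L - {\<alpha>}" for \<gamma> and f :: "'a \<Rightarrow> 't \<Rightarrow> int"
  proof -
    have "(\<Sum>(\<beta>, t)\<in>T. if \<beta> = \<gamma> then f \<beta> t else 0) =
        (\<Sum>\<beta>\<in>L - {\<alpha>}. \<Sum>t\<in>U \<beta>. if \<beta> = \<gamma> then f \<beta> t else 0)"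
      unfolding T_def using \<open>finite L\<close> U by (subst sum.Sigma) auto
    also have "\<dots> = (\<Sum>\<beta>\<in>L - {\<alpha>}. if \<beta> = \<gamma> then \<Sum>t\<in>U \<gamma>. f \<gamma> t else 0)"
      by (intro sum.cong) auto
    finally show ?thesis
      using \<open>finite L\<close> that by (simp add: sum.delta)
  qed
  have "card (?key q ` X s) \<le> C q * s ^ e" if q_T: "q \<in> T" for q
  proof -
    obtain \<beta> t where q: "q = (\<beta>, t)" "\<beta> \<in> L - {\<alpha>}" "t \<in> U \<beta>"
      using q_T unfolding T_def by blast
    let ?I = "{- (\<bar>B \<beta> t\<bar> * int s)..\<bar>B \<beta> t\<bar> * int s}"
    have "B \<beta> t * int s \<le> \<bar>B \<beta> t\<bar> * int s" by (intro mult_right_mono) auto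
    then have "key \<beta> t ` X s \<subseteq> {zs. set zs \<subseteq> ?I \<and> length zs = e}"
      using key[OF q(2,3)] by fastforce
    then have "card (key \<beta> t ` X s) \<le> card {zs. set zs \<subseteq> ?I \<and> length zs = e}"
      by (intro card_mono finite_lists_length_eq) auto
    also have "\<dots> = card ?I ^ e" by (rule card_lists_length_eq) simp
    also have "card ?I \<le> nat (2 * \<bar>B \<beta> t\<bar> + 1) * s"
    proof -
      have "int (card ?I) = 2 * (\<bar>B \<beta> t\<bar> * int s) + 1" by simp
      also have "\<dots> \<le> (2 * \<bar>B \<beta> t\<bar> + 1) * int s" using s by (simp add: algebra_simps)
      also have "\<dots> = int (nat (2 * \<bar>B \<beta> t\<bar> + 1) * s)" by simp
      finally show ?thesis by linarith
    qed
    then have "card ?I ^ e \<le> C q * s ^ e"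
      unfolding C_def q(1) prod.case power_mult_distrib[symmetric] by (intro power_mono) auto
    finally show ?thesis by (simp add: q(1))
  qed
  then have "(\<Sum>q\<in>T. card (?key q ` X s)) \<le> (\<Sum>q\<in>T. C q) * s ^ e"
    by (simp only: sum_distrib_right sum_mono)
  moreover have "1 \<le> s ^ e" using s by simp
  ultimately have "1 + (\<Sum>q\<in>T. card (?key q ` X s)) \<le> (1 + (\<Sum>q\<in>T. C q)) * s ^ e"
    by (simp only: distrib_right)
  moreover have "card (X s) \<in> L_sizes (1 + (\<Sum>q\<in>T. card (?key q ` X s))) L"
  proof (rule card_mem_L_sizes_of_relation[OF assms(1,3,4) X(1) T])
    show "(\<Sum>q\<in>T. ?\<epsilon> \<gamma> q) = A \<gamma>" if "\<gamma> \<in> L - {\<alpha>}" for \<gamma>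
      using sum_T[OF that, of \<epsilon>] diag[OF that] by simp
    fix x y assume xy: "x \<in> X s" "y \<in> X s" "x \<noteq> y"
    have "(\<Sum>q\<in>T. if ?key q x = ?key q y then ?\<epsilon> \<gamma> q else 0) =
        (\<Sum>t\<in>U \<gamma>. if key \<gamma> t x = key \<gamma> t y then \<epsilon> \<gamma> t else 0)" if "\<gamma> \<in> L - {\<alpha>}" for \<gamma>
      by (subst sum_T[OF that, of "\<lambda>\<beta> t. if key \<beta> t x = key \<beta> t y then \<epsilon> \<beta> t else 0", symmetric])
        (intro sum.cong, auto)
    then show "\<exists>\<gamma>\<in>L. \<forall>\<beta>\<in>L - {\<alpha>}.
        (\<Sum>q\<in>T. if ?key q x = ?key q y then ?\<epsilon> \<beta> q else 0) = of_bool (\<beta> = \<gamma>)"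
      using offdiag[OF xy] by simp
  qed
  ultimately show "s ^ d \<in> L_sizes ((1 + (\<Sum>(\<beta>, t)\<in>(SIGMA \<beta>:L - {\<alpha>}. U \<beta>). nat (2 * \<bar>B \<beta> t\<bar> + 1) ^ e)) * s ^ e) L"
    unfolding C_def T_def X(2) using L_sizes_mono by blast
qed (use assms in auto)

subsection \<open>Configurations of subspaces\<close>

lemma sum_if_unique:
  fixes f :: "'t \<Rightarrow> 'b::comm_monoid_add"
  assumes "finite T" "t \<in> T" "P t" "\<And>u. u \<in> T \<Longrightarrow> P u \<Longrightarrow> u = t"
  shows "(\<Sum>u\<in>T. if P u then f u else 0) = f t"
proof -
  have "(\<Sum>u\<in>T. if P u then f u else 0) = (\<Sum>u\<in>T. if u = t then f t else 0)"
    using assms(3,4) by (intro sum.cong refl) metis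
  then show ?thesis using assms(1,2) by (simp add: sum.delta)
qed

lemma sum_insert_None_Plus:
  assumes "finite S" "finite S'"
  shows "(\<Sum>t\<in>insert None (Some ` (S <+> S')). f t) =
    f None + ((\<Sum>i\<in>S. f (Some (Inl i))) + (\<Sum>i\<in>S'. f (Some (Inr i))))"
  using assms by (simp add: sum.reindex sum.Plus comp_def)

text \<open>With nonnegative coefficients, lines through 0 in the plane do: \<open>A \<beta>\<close>
  of them for \<open>\<beta>\<close>, any two meeting only in 0.\<close>

proposition N_bigomega_square:
  fixes L :: "'a::field set"
  assumes L: "finite L" "0 \<notin> L" and rel: "primitive_relation L A" "\<alpha> \<in> L"
    and pos: "\<And>\<beta>. \<beta> \<in> L - {\<alpha>} \<Longrightarrow> A \<beta> \<ge> 0"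
  shows "(\<lambda>r. real (N r L)) \<in> \<Omega>(\<lambda>r. real r powr 2)"
proof -
  define T where "T = (SIGMA \<beta>:L - {\<alpha>}. {..<nat (A \<beta>)})"
  \<comment> \<open>\<open>\<sigma>\<close> makes the lines distinct across all elements, not only
    for a single \<open>\<beta>\<close>.\<close>
  obtain \<sigma> :: "'a \<times> nat \<Rightarrow> nat" where \<sigma>: "inj_on \<sigma> T"
    using finite_imp_inj_to_nat_seg[of T] L(1) by (auto simp: T_def)
  define key where "key \<beta> i = (\<lambda>(a, b). [a + int (\<sigma> (\<beta>, i)) * b])" for \<beta> i
  have "(\<lambda>r. real (N r L)) \<in> \<Omega>(\<lambda>r. real r powr (real 2 / real 1))"
  proof (rule N_bigomega_of_relation[OF L rel, where
        U = "\<lambda>\<beta>. {..<nat (A \<beta>)}" and \<epsilon> = "\<lambda>_ _. 1" and key = key and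
        X = "\<lambda>s. {0..<int s} \<times> {0..<int s}" and B = "\<lambda>\<beta> i. 1 + int (\<sigma> (\<beta>, i))"])
    fix s \<beta> i x assume x: "x \<in> {0..<int s} \<times> {0..<int s}"
    obtain a b where ab: "x = (a, b)" "0 \<le> a" "a \<le> int s" "0 \<le> b" "b \<le> int s"
      using x by auto
    have "int (\<sigma> (\<beta>, i)) * b \<le> int (\<sigma> (\<beta>, i)) * int s"
      using ab by (intro mult_left_mono) auto
    then show "length (key \<beta> i x) = 1 \<and> (\<forall>z\<in>set (key \<beta> i x). \<bar>z\<bar> \<le> (1 + int (\<sigma> (\<beta>, i))) * int s)"
      using ab by (simp add: key_def distrib_right)
  next
    fix s x y assume "x \<in> {0..<int s} \<times> {0..<int s}" "y \<in> {0..<int s} \<times> {0..<int s}" "x \<noteq> y"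
    then obtain a b a' b' where xy: "x = (a, b)" "y = (a', b')" "(a, b) \<noteq> (a', b')"
      by (cases x; cases y) auto
    have uniq: "\<beta> = \<gamma> \<and> i = j" if "(\<beta>, i) \<in> T" "(\<gamma>, j) \<in> T" "key \<beta> i x = key \<beta> i y" "key \<gamma> j x = key \<gamma> j y"
      for \<beta> \<gamma> i j
    proof -
      have "(int (\<sigma> (\<beta>, i)) - int (\<sigma> (\<gamma>, j))) * (b - b') =
          (a + int (\<sigma> (\<beta>, i)) * b - (a' + int (\<sigma> (\<beta>, i)) * b')) -
          (a + int (\<sigma> (\<gamma>, j)) * b - (a' + int (\<sigma> (\<gamma>, j)) * b'))"
        by (simp add: algebra_simps)
      also have "\<dots> = 0"
        using that(3,4) by (simp add: key_def xy)
      finally have "(int (\<sigma> (\<beta>, i)) - int (\<sigma> (\<gamma>, j))) * (b - b') = 0" .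
      \<comment> \<open>Equality \<open>b = b'\<close> would force \<open>a = a'\<close> through the
        shared key.\<close>
      moreover have "b \<noteq> b'"
        using that(3) xy(3) unfolding xy key_def by auto
      ultimately show ?thesis
        using inj_onD[OF \<sigma>, of "(\<beta>, i)" "(\<gamma>, j)"] that(1,2) by auto
    qed
    show "\<exists>\<gamma>\<in>L. \<forall>\<beta>\<in>L - {\<alpha>}. (\<Sum>t<nat (A \<beta>). if key \<beta> t x = key \<beta> t y then 1 else (0::int)) = of_bool (\<beta> = \<gamma>)"
    proof (cases "\<exists>(\<gamma>, j)\<in>T. key \<gamma> j x = key \<gamma> j y")
      case True
      then obtain \<gamma> j where \<gamma>: "(\<gamma>, j) \<in> T" "key \<gamma> j x = key \<gamma> j y" by auto
      have "(\<Sum>t<nat (A \<beta>). if key \<beta> t x = key \<beta> t y then 1 else (0::int)) = of_bool (\<beta> = \<gamma>)"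
        if \<beta>: "\<beta> \<in> L - {\<alpha>}" for \<beta>
      proof (cases "\<beta> = \<gamma>")
        case True
        have "i = j" if "i \<in> {..<nat (A \<gamma>)}" "key \<gamma> i x = key \<gamma> i y" for i
          using uniq[of \<gamma> i \<gamma> j] that \<gamma> by (auto simp: T_def)
        moreover have "j \<in> {..<nat (A \<gamma>)}"
          using \<gamma>(1) by (auto simp: T_def)
        ultimately have "(\<Sum>t<nat (A \<gamma>). if key \<gamma> t x = key \<gamma> t y then 1 else 0) = (1::int)"
          using sum_if_unique[of "{..<nat (A \<gamma>)}" j "\<lambda>t. key \<gamma> t x = key \<gamma> t y" "\<lambda>_. 1"] \<gamma>(2)
          by blast
        then show ?thesis
          using True by simp
      next
        case False
        have "key \<beta> i x \<noteq> key \<beta> i y" if "i \<in> {..<nat (A \<beta>)}" for i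
          using uniq[of \<beta> i \<gamma> j] that \<gamma> False \<beta> by (auto simp: T_def)
        then show ?thesis
          using False by simp
      qed
      then show ?thesis
        using \<gamma>(1) by (intro bexI[of _ \<gamma>]) (auto simp: T_def)
    next
      case False
      \<comment> \<open>Off all lines every count vanishes and the entry is
        \<open>\<alpha>\<close>.\<close>
      then have "key \<beta> t x \<noteq> key \<beta> t y" if "\<beta> \<in> L - {\<alpha>}" "t \<in> {..<nat (A \<beta>)}" for \<beta> t
        using that unfolding T_def by blast
      then show ?thesis
        using rel(2) by (intro bexI[of _ \<alpha>]) simp_all
    qed
  qed (use pos in \<open>auto simp: power2_eq_square\<close>)
  then show ?thesis by simp
qed


text \<open>A vector \<open>(v\<^sub>1, v\<^sub>2, v\<^sub>3)\<close> of \<open>\<int>\<^sup>3\<close> is read as the polynomial \<open>v\<^sub>1 + v\<^sub>2 t + v\<^sub>3 t\<^sup>2\<close>.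
  Having the root \<open>j\<close> is membership in a plane, and being proportional to \<open>(t - x) (t - y)\<close> is
  membership in a line; so lines are unordered pairs of roots, and two planes meet in the line of
  the two corresponding roots.

  With the elements of \<open>L\<close> numbered below \<open>k \<le> E\<close>, the element \<open>\<beta>\<close> of number \<open>j\<close> uses the plane
  of root \<open>j\<close> minus the \<open>E + 1\<close> lines of roots \<open>{j, y}\<close> with \<open>y \<le> E\<close>, which include the intersections
  with the planes of all other elements, plus \<open>A\<^sub>\<beta> + E\<close> lines whose roots exceed \<open>E\<close>, so that they
  lie outside all planes.\<close>

definition has_root :: "int \<Rightarrow> int \<times> int \<times> int \<Rightarrow> bool" where
  "has_root j = (\<lambda>(v1, v2, v3). v1 + j * v2 + j * j * v3 = 0)"

definition has_root_pair :: "int \<Rightarrow> int \<Rightarrow> int \<times> int \<times> int \<Rightarrow> bool" where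
  "has_root_pair x y = (\<lambda>(v1, v2, v3). v1 = x * y * v3 \<and> v2 = - (x + y) * v3)"

lemma has_root_pair_commute: "has_root_pair x y = has_root_pair y x"
  by (simp add: has_root_pair_def algebra_simps)

lemma has_root_pair_nonzero: "has_root_pair x y (v1, v2, v3) \<Longrightarrow> (v1, v2, v3) \<noteq> 0 \<Longrightarrow> v3 \<noteq> 0"
  by (auto simp: has_root_pair_def zero_prod_def)

text \<open>The polynomial equals \<open>v3 * (t - x) * (t - y)\<close> with nonzero leading
  coefficient.\<close>

lemma has_root_iff_of_pair:
  assumes "has_root_pair x y v" "v \<noteq> 0"
  shows "has_root j v \<longleftrightarrow> j = x \<or> j = y"
proof -
  obtain v1 v2 v3 where v: "v = (v1, v2, v3)" by (cases v) auto
  have coeffs: "v1 = x * y * v3" "v2 = - (x + y) * v3"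
    using assms(1) by (simp_all add: v has_root_pair_def)
  have "v1 + j * v2 + j * j * v3 = (j - x) * (j - y) * v3"
    unfolding coeffs by (simp add: algebra_simps)
  then show ?thesis
    using has_root_pair_nonzero assms by (auto simp: v has_root_def)
qed

text \<open>Both pairs have the same sum and share a root, which settles double roots as
  well.\<close>

lemma has_root_pair_unique:
  assumes "has_root_pair x y v" "has_root_pair x' y' v" "v \<noteq> 0"
  shows "(x' = x \<and> y' = y) \<or> (x' = y \<and> y' = x)"
proof -
  obtain v1 v2 v3 where v: "v = (v1, v2, v3)" by (cases v) auto
  have "v3 \<noteq> 0"
    using has_root_pair_nonzero assms by (auto simp: v)
  moreover have "(x + y) * v3 = (x' + y') * v3"
    using assms(1,2) by (simp add: v has_root_pair_def algebra_simps)
  ultimately have "x + y = x' + y'"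
    by simp
  moreover have "x' = x \<or> x' = y"
    using has_root_iff_of_pair[OF assms(1,3)] has_root_iff_of_pair[OF assms(2,3)] by blast
  ultimately show ?thesis by auto
qed

lemma has_root_pairI:
  assumes "has_root x v" "has_root y v" "x \<noteq> y"
  shows "has_root_pair x y v"
proof -
  obtain v1 v2 v3 where v: "v = (v1, v2, v3)" by (cases v) auto
  have "(x - y) * (v2 + (x + y) * v3) = (v1 + x * v2 + x * x * v3) - (v1 + y * v2 + y * y * v3)"
    by (simp add: algebra_simps)
  also have "\<dots> = 0"
    using assms(1,2) by (simp add: v has_root_def)
  finally have "v2 + (x + y) * v3 = 0"
    using assms(3) by simp
  then have v2: "v2 = - (x + y) * v3"
    by (simp only: mult_minus_left eq_neg_iff_add_eq_0)
  have "v1 = - x * v2 - x * x * v3"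
    using assms(1) by (simp add: v has_root_def)
  also have "\<dots> = x * y * v3"
    unfolding v2 by (simp add: algebra_simps)
  finally show ?thesis
    using v2 by (simp add: v has_root_pair_def)
qed

proposition N_bigomega_three_halves:
  fixes L :: "'a::field set"
  assumes L: "finite L" "0 \<notin> L" and rel: "primitive_relation L A" "\<alpha> \<in> L"
  shows "(\<lambda>r. real (N r L)) \<in> \<Omega>(\<lambda>r. real r powr (3/2))"
proof -
  obtain idx :: "'a \<Rightarrow> nat" and k where idx: "inj_on idx L" "idx ` L = {i. i < k}"
    using finite_imp_inj_to_nat_seg[OF L(1)] by metis
  have idx_less: "idx \<beta> < k" if "\<beta> \<in> L" for \<beta>
    using idx(2) that by blast
  \<comment> \<open>Large enough that all element numbers are at most \<open>E\<close> and that the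
    \<open>A \<beta> + E\<close> added lines are a nonnegative number. At 0 the total is
    \<open>1 - (E + 1) + (A \<beta> + E) = A \<beta>\<close>.\<close>
  define E where "E = k + (\<Sum>\<beta>\<in>L. nat \<bar>A \<beta>\<bar>)"
  have E: "k \<le> E" "A \<beta> + int E \<ge> 0" if "\<beta> \<in> L" for \<beta>
  proof -
    have "\<bar>A \<beta>\<bar> \<le> (\<Sum>\<beta>\<in>L. \<bar>A \<beta>\<bar>)"
      using L(1) that by (intro member_le_sum) auto
    then show "A \<beta> + int E \<ge> 0" by (simp add: E_def)
  qed (simp add: E_def)
  \<comment> \<open>The values of \<open>px\<close> on \<open>L\<close> lie in
    \<open>E + 1..E + k\<close> and those of \<open>py\<close> above, so even an unordered pair
    \<open>{px \<beta>, py i}\<close> determines \<open>\<beta>\<close> and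
    \<open>i\<close>.\<close>
  define px where "px \<beta> = int (E + 1 + idx \<beta>)" for \<beta>
  define py where "py i = int (E + 1 + k + i)" for i :: nat
  define U where "U \<beta> = insert None (Some ` ({..E} <+> {..<nat (A \<beta> + int E)}))" for \<beta>
  \<comment> \<open>A plane is cut out by one linear form; the 0 pads its key to the common length
    2.\<close>
  define kroot :: "int \<Rightarrow> int \<times> int \<times> int \<Rightarrow> int list"
    where "kroot j = (\<lambda>(v1, v2, v3). [v1 + j * v2 + j * j * v3, 0])" for j
  define kpair :: "int \<Rightarrow> int \<Rightarrow> int \<times> int \<times> int \<Rightarrow> int list"
    where "kpair x y = (\<lambda>(v1, v2, v3). [v1 - x * y * v3, v2 + (x + y) * v3])" for x y
  define key :: "'a \<Rightarrow> (nat + nat) option \<Rightarrow> int \<times> int \<times> int \<Rightarrow> int list"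
    where "key \<beta> = case_option (kroot (int (idx \<beta>)))
      (case_sum (\<lambda>y. kpair (int (idx \<beta>)) (int y)) (\<lambda>i. kpair (px \<beta>) (py i)))" for \<beta>
  define \<epsilon> :: "'a \<Rightarrow> (nat + nat) option \<Rightarrow> int"
    where "\<epsilon> \<beta> = case_option 1 (case_sum (\<lambda>_. - 1) (\<lambda>_. 1))" for \<beta>
  have kroot: "kroot j p = kroot j p' \<longleftrightarrow> has_root j (p - p')" for j p p'
    by (cases p; cases p') (auto simp: kroot_def has_root_def algebra_simps)
  have kpair: "kpair x y p = kpair x y p' \<longleftrightarrow> has_root_pair x y (p - p')" for x y p p'
    by (cases p; cases p') (auto simp: kpair_def has_root_pair_def algebra_simps)
  have "(\<lambda>r. real (N r L)) \<in> \<Omega>(\<lambda>r. real r powr (real 3 / real 2))"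
  proof (rule N_bigomega_of_relation[OF L rel, where U = U and \<epsilon> = \<epsilon> and key = key and
        X = "\<lambda>s. {0..<int s} \<times> {0..<int s} \<times> {0..<int s}" and
        B = "\<lambda>\<beta> t. case_option (1 + int (idx \<beta>) + int (idx \<beta>) * int (idx \<beta>))
          (case_sum (\<lambda>y. 2 + int (idx \<beta>) * int y + int (idx \<beta>) + int y)
          (\<lambda>i. 2 + px \<beta> * py i + px \<beta> + py i)) t"])
    fix s \<beta> t p assume p: "p \<in> {0..<int s} \<times> {0..<int s} \<times> {0..<int s}"
    obtain p1 p2 p3 where ps: "p = (p1, p2, p3)" "0 \<le> p1" "p1 \<le> int s" "0 \<le> p2" "p2 \<le> int s" "0 \<le> p3" "p3 \<le> int s"
      using p by auto
    have mono: "0 \<le> x * q" "x * q \<le> x * int s" if "0 \<le> x" "0 \<le> q" "q \<le> int s" for x q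
      using that by (auto intro: mult_left_mono)
    have root: "length (kroot j p) = 2 \<and> (\<forall>z\<in>set (kroot j p). \<bar>z\<bar> \<le> (1 + j + j * j) * int s)" if "j \<ge> 0" for j
      using ps mono[of j p2] mono[of "j * j" p3] that by (simp add: kroot_def distrib_right)
    have pair: "length (kpair x y p) = 2 \<and> (\<forall>z\<in>set (kpair x y p). \<bar>z\<bar> \<le> (2 + x * y + x + y) * int s)"
      if "x \<ge> 0" "y \<ge> 0" for x y
    proof -
      have "0 \<le> x * y"
        using that by simp
      note bounds = mono[OF this ps(6,7)] mono[OF that(1) ps(6,7)] mono[OF that(2) ps(6,7)] ps
      have "\<bar>p1 - x * y * p3\<bar> \<le> 2 * int s + x * y * int s + x * int s + y * int s"
        using bounds by linarith
      moreover have "\<bar>p2 + (x * p3 + y * p3)\<bar> \<le> 2 * int s + x * y * int s + x * int s + y * int s"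
        using bounds by linarith
      ultimately show ?thesis
        by (simp add: ps(1) kpair_def distrib_right)
    qed
    show "length (key \<beta> t p) = 2 \<and> (\<forall>z\<in>set (key \<beta> t p). \<bar>z\<bar> \<le>
        case_option (1 + int (idx \<beta>) + int (idx \<beta>) * int (idx \<beta>))
          (case_sum (\<lambda>y. 2 + int (idx \<beta>) * int y + int (idx \<beta>) + int y)
          (\<lambda>i. 2 + px \<beta> * py i + px \<beta> + py i)) t * int s)"
    proof -
      have "px \<beta> \<ge> 0" "py i \<ge> 0" for i
        by (simp_all add: px_def py_def)
      then show ?thesis
        unfolding key_def using root pair by (simp split: option.split sum.split)
    qed
  next
    fix \<beta> assume "\<beta> \<in> L - {\<alpha>}"
    then show "(\<Sum>t\<in>U \<beta>. \<epsilon> \<beta> t) = A \<beta>"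
      unfolding U_def sum_insert_None_Plus[OF finite_atMost finite_lessThan]
      using E by (simp add: \<epsilon>_def)
  next
    fix s p p' assume "(p :: int \<times> int \<times> int) \<noteq> p'"
    define v where "v = p - p'"
    have v0: "v \<noteq> 0" using \<open>p \<noteq> p'\<close> by (simp add: v_def)
    define inn where "inn \<beta> y \<longleftrightarrow> has_root_pair (int (idx \<beta>)) (int y) v" for \<beta> y
    define out where "out \<beta> i \<longleftrightarrow> has_root_pair (px \<beta>) (py i) v" for \<beta> i
    define root where "root \<beta> \<longleftrightarrow> has_root (int (idx \<beta>)) v" for \<beta>
    define F where "F \<beta> = of_bool (root \<beta>) + ((\<Sum>y\<le>E. if inn \<beta> y then - 1 else 0) +
      (\<Sum>i<nat (A \<beta> + int E). if out \<beta> i then 1 else (0 :: int)))" for \<beta>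
    have F: "(\<Sum>t\<in>U \<beta>. if key \<beta> t p = key \<beta> t p' then \<epsilon> \<beta> t else 0) = F \<beta>" for \<beta>
      unfolding U_def sum_insert_None_Plus[OF finite_atMost finite_lessThan]
      by (simp add: \<epsilon>_def key_def kroot kpair F_def inn_def out_def root_def v_def cong: if_cong)
    have inn_root: "root \<beta>" if "inn \<beta> y" for \<beta> y
      using has_root_iff_of_pair[OF _ v0] that unfolding inn_def root_def by blast
    have idx_eq: "\<beta> = \<gamma>" if "\<beta> \<in> L" "\<gamma> \<in> L" "idx \<beta> = idx \<gamma>" for \<beta> \<gamma>
      using idx(1) that by (auto simp: inj_on_def)
    \<comment> \<open>On an added line of \<open>\<gamma>\<close> the entry is
      \<open>\<gamma>\<close>; on a removed line it is \<open>\<alpha>\<close>; elsewhere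
      \<open>v\<close> lies in at most one plane, which decides the entry.\<close>
    consider (outer) \<gamma> i where "\<gamma> \<in> L - {\<alpha>}" "i < nat (A \<gamma> + int E)" "out \<gamma> i"
      | (inner) \<gamma> y where "\<gamma> \<in> L" "y \<le> E" "inn \<gamma> y" "\<And>\<beta> i. \<beta> \<in> L - {\<alpha>} \<Longrightarrow> i < nat (A \<beta> + int E) \<Longrightarrow> \<not> out \<beta> i"
      | (none) "\<And>\<beta> y. \<beta> \<in> L \<Longrightarrow> y \<le> E \<Longrightarrow> \<not> inn \<beta> y" "\<And>\<beta> i. \<beta> \<in> L - {\<alpha>} \<Longrightarrow> i < nat (A \<beta> + int E) \<Longrightarrow> \<not> out \<beta> i"
      by blast
    then have "\<exists>\<gamma>\<in>L. \<forall>\<beta>\<in>L - {\<alpha>}. F \<beta> = of_bool (\<beta> = \<gamma>)"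
    proof cases
      case outer
      have no_root: "\<not> root \<beta>" if "\<beta> \<in> L" for \<beta>
        using has_root_iff_of_pair[OF outer(3)[unfolded out_def] v0, of "int (idx \<beta>)"]
          idx_less[OF that] E(1)[OF that] by (auto simp: root_def px_def py_def)
      have out_iff: "out \<beta> j \<longleftrightarrow> \<beta> = \<gamma> \<and> j = i" if "\<beta> \<in> L" for \<beta> j
      proof
        assume "out \<beta> j"
        then have "idx \<beta> = idx \<gamma> \<and> j = i"
          using has_root_pair_unique[OF outer(3)[unfolded out_def] _ v0, of "px \<beta>" "py j"]
            idx_less[OF that] idx_less[of \<gamma>] outer(1)
          by (auto simp: out_def px_def py_def)
        then show "\<beta> = \<gamma> \<and> j = i"
          using idx_eq that outer(1) by auto
      qed (use outer in auto)
      have "F \<beta> = of_bool (\<beta> = \<gamma>)" if \<beta>: "\<beta> \<in> L - {\<alpha>}" for \<beta>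
      proof -
        have "\<not> inn \<beta> y" for y
          using inn_root no_root \<beta> by blast
        then show ?thesis
          using \<beta> no_root[of \<beta>] outer(2) by (auto simp: F_def out_iff)
      qed
      then show ?thesis using outer(1) by blast
    next
      case inner
      have "F \<beta> = 0" if \<beta>: "\<beta> \<in> L - {\<alpha>}" for \<beta>
      proof -
        have no_out: "(\<Sum>i<nat (A \<beta> + int E). if out \<beta> i then 1 else (0 :: int)) = 0"
          using inner(4)[OF \<beta>] by (intro sum.neutral) auto
        show ?thesis
        proof (cases "root \<beta>")
          case True
          \<comment> \<open>If \<open>v\<close> lies in the plane of \<open>\<beta>\<close> and on a
            removed line of \<open>\<gamma>\<close>, then \<open>idx \<beta>\<close> is one of the
            two roots, so this line is also removed for \<open>\<beta>\<close>, and exactly once;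
            plane and line cancel.\<close>
          have "int (idx \<beta>) = int (idx \<gamma>) \<or> int (idx \<beta>) = int y"
            using has_root_iff_of_pair[OF inner(3)[unfolded inn_def] v0] True by (simp add: root_def)
          then obtain z where z: "z \<le> E" "inn \<beta> z"
          proof
            assume "int (idx \<beta>) = int (idx \<gamma>)"
            then show thesis using that[of y] inner(2,3) by (simp add: inn_def)
          next
            assume "int (idx \<beta>) = int y"
            then show thesis using that[of "idx \<gamma>"] inner(1,3) idx_less[OF inner(1)] E(1)[OF inner(1)]
              by (simp add: inn_def has_root_pair_commute)
          qed
          have "u = z" if "inn \<beta> u" for u
            using has_root_pair_unique[OF z(2)[unfolded inn_def] that[unfolded inn_def] v0] by auto
          then have "(\<Sum>y\<le>E. if inn \<beta> y then - 1 else 0) = (- 1 :: int)"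
            using sum_if_unique[of "{..E}" z "inn \<beta>" "\<lambda>_. - 1"] z by blast
          then show ?thesis using True no_out by (simp add: F_def)
        next
          case False
          then have "\<not> inn \<beta> y" for y using inn_root by blast
          then show ?thesis using False no_out by (simp add: F_def)
        qed
      qed
      then show ?thesis using rel(2) by (intro bexI[of _ \<alpha>]) auto
    next
      case none
      have F_root: "F \<beta> = of_bool (root \<beta>)" if "\<beta> \<in> L - {\<alpha>}" for \<beta>
      proof -
        have "(\<Sum>y\<le>E. if inn \<beta> y then - 1 else 0) = (0 :: int)"
          "(\<Sum>i<nat (A \<beta> + int E). if out \<beta> i then 1 else (0 :: int)) = 0"
          using none that by (auto intro!: sum.neutral)
        then show ?thesis by (simp add: F_def)
      qed
      \<comment> \<open>Two planes meet in the line of roots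
        \<open>{idx \<beta>, idx \<gamma>}\<close>, a removed one because
        \<open>idx \<gamma> < k \<le> E\<close>.\<close>
      have root_unique: "\<beta> = \<gamma>" if "\<beta> \<in> L" "\<gamma> \<in> L" "root \<beta>" "root \<gamma>" for \<beta> \<gamma>
      proof (rule ccontr)
        assume "\<beta> \<noteq> \<gamma>"
        then have "inn \<beta> (idx \<gamma>)"
          using has_root_pairI[of "int (idx \<beta>)" v "int (idx \<gamma>)"] that idx_eq by (auto simp: inn_def root_def)
        then show False
          using none(1)[of \<beta> "idx \<gamma>"] that idx_less[of \<gamma>] E(1)[of \<gamma>] by auto
      qed
      show ?thesis
      proof (cases "\<exists>\<gamma>\<in>L - {\<alpha>}. root \<gamma>")
        case True
        then obtain \<gamma> where "\<gamma> \<in> L - {\<alpha>}" "root \<gamma>" by blast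
        then show ?thesis
          using F_root root_unique by (intro bexI[of _ \<gamma>]) auto
      next
        case False
        then show ?thesis
          using F_root rel(2) by (intro bexI[of _ \<alpha>]) auto
      qed
    qed
    then show "\<exists>\<gamma>\<in>L. \<forall>\<beta>\<in>L - {\<alpha>}.
        (\<Sum>t\<in>U \<beta>. if key \<beta> t p = key \<beta> t p' then \<epsilon> \<beta> t else 0) = of_bool (\<beta> = \<gamma>)"
      by (simp add: F)
  qed (auto simp: U_def power3_eq_cube mult.assoc)
  then show ?thesis by simp
qed


text \<open>In \<open>\<int>\<^sup>5\<close> with coordinates \<open>(p, q, h)\<close>, where \<open>p\<close> and \<open>q\<close> are in \<open>\<int>\<^sup>2\<close>, the element \<open>\<beta>\<close> of negative
  coefficient uses the hyperplane \<open>h = 0\<close> minus the planes \<open>h = 0, p = i q\<close>, which form a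
  partial spread of it, and the element \<open>\<gamma>\<close> uses the planes \<open>p = (i h, 0), q\<^sub>2 = i q\<^sub>1\<close>,
  which meet the hyperplane inside \<open>h = 0, p = 0\<close>.\<close>

proposition N_bigomega_five_thirds:
  fixes L :: "'a::field set"
  assumes L: "finite L" "0 \<notin> L" and rel: "primitive_relation L A" "\<alpha> \<in> L"
    and rest: "L - {\<alpha>} = {\<beta>, \<gamma>}" "\<beta> \<noteq> \<gamma>" and coeffs: "A \<beta> \<le> 0" "A \<gamma> \<ge> 0"
  shows "(\<lambda>r. real (N r L)) \<in> \<Omega>(\<lambda>r. real r powr (5/3))"
proof -
  \<comment> \<open>The removed planes are numbered \<open>0..m\<close>, so \<open>\<beta>\<close>
    gets the total \<open>1 - (m + 1) = A \<beta>\<close> at 0.\<close>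
  define m where "m = nat (- A \<beta>)"
  define n where "n = nat (A \<gamma>)"
  define U :: "'a \<Rightarrow> (nat + nat) option set"
    where "U \<delta> = (if \<delta> = \<beta> then insert None (Some ` ({..m} <+> {})) else Some ` ({} <+> {..<n}))" for \<delta>
  \<comment> \<open>The zeros pad the single equation of the hyperplane to the common length
    3.\<close>
  define key :: "'a \<Rightarrow> (nat + nat) option \<Rightarrow> int \<times> int \<times> int \<times> int \<times> int \<Rightarrow> int list"
    where "key \<delta> t = (\<lambda>(p1, p2, q1, q2, h). case t of None \<Rightarrow> [h, 0, 0]
      | Some (Inl i) \<Rightarrow> [h, p1 - int i * q1, p2 - int i * q2]
      | Some (Inr i) \<Rightarrow> [p1 - int i * h, p2, q2 - int i * q1])" for \<delta> t
  define \<epsilon> :: "'a \<Rightarrow> (nat + nat) option \<Rightarrow> int"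
    where "\<epsilon> \<delta> = case_option 1 (case_sum (\<lambda>_. - 1) (\<lambda>_. 1))" for \<delta>
  have sum_\<beta>: "(\<Sum>t\<in>U \<beta>. f t) = f None + (\<Sum>i\<le>m. f (Some (Inl i)))" for f :: "(nat + nat) option \<Rightarrow> int"
    using sum_insert_None_Plus[of "{..m}" "{}" f] by (simp add: U_def)
  have sum_\<gamma>: "(\<Sum>t\<in>U \<gamma>. f t) = (\<Sum>i<n. f (Some (Inr i)))" for f :: "(nat + nat) option \<Rightarrow> int"
    using rest(2) by (simp add: U_def sum.reindex sum.Plus comp_def)
  have "(\<lambda>r. real (N r L)) \<in> \<Omega>(\<lambda>r. real r powr (real 5 / real 3))"
  proof (rule N_bigomega_of_relation[OF L rel, where U = U and \<epsilon> = \<epsilon> and key = key and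
        X = "\<lambda>s. {0..<int s} \<times> {0..<int s} \<times> {0..<int s} \<times> {0..<int s} \<times> {0..<int s}" and
        B = "\<lambda>\<delta>. case_option 1 (case_sum (\<lambda>i. 1 + int i) (\<lambda>i. 1 + int i))"])
    fix s \<delta> t p assume p: "p \<in> {0..<int s} \<times> {0..<int s} \<times> {0..<int s} \<times> {0..<int s} \<times> {0..<int s}"
    obtain p1 p2 q1 q2 h where ps: "p = (p1, p2, q1, q2, h)" "0 \<le> p1" "p1 \<le> int s" "0 \<le> p2" "p2 \<le> int s"
        "0 \<le> q1" "q1 \<le> int s" "0 \<le> q2" "q2 \<le> int s" "0 \<le> h" "h \<le> int s"
      using p by auto
    have diff: "\<bar>a - int i * b\<bar> \<le> (1 + int i) * int s" "\<bar>a\<bar> \<le> (1 + int i) * int s"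
      if "0 \<le> a" "a \<le> int s" "0 \<le> b" "b \<le> int s" for a b i
    proof -
      have "0 \<le> int i * b" "int i * b \<le> int i * int s"
        using that by (auto intro: mult_left_mono)
      then show "\<bar>a - int i * b\<bar> \<le> (1 + int i) * int s" "\<bar>a\<bar> \<le> (1 + int i) * int s"
        using that unfolding distrib_right by linarith+
    qed
    show "length (key \<delta> t p) = 3 \<and> (\<forall>z\<in>set (key \<delta> t p). \<bar>z\<bar> \<le>
        case_option 1 (case_sum (\<lambda>i. 1 + int i) (\<lambda>i. 1 + int i)) t * int s)"
      using diff ps(2-) unfolding key_def ps(1) by (simp split: option.split sum.split)
  next
    fix \<delta> assume "\<delta> \<in> L - {\<alpha>}"
    then show "(\<Sum>t\<in>U \<delta>. \<epsilon> \<delta> t) = A \<delta>"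
      using coeffs unfolding rest by (auto simp: sum_\<beta> sum_\<gamma> \<epsilon>_def m_def n_def)
  next
    fix s p p' assume "(p :: int \<times> int \<times> int \<times> int \<times> int) \<noteq> p'"
    obtain p1 p2 q1 q2 h where v: "p - p' = (p1, p2, q1, q2, h)"
      by (cases "p - p'") auto
    have v0: "(p1, p2, q1, q2, h) \<noteq> (0, 0, 0, 0, 0)"
      using \<open>p \<noteq> p'\<close> v by (auto simp flip: zero_prod_def)
    define inn where "inn i \<longleftrightarrow> h = 0 \<and> p1 = int i * q1 \<and> p2 = int i * q2" for i
    define out where "out i \<longleftrightarrow> p1 = int i * h \<and> p2 = 0 \<and> q2 = int i * q1" for i
    have keys: "key \<delta> None p = key \<delta> None p' \<longleftrightarrow> h = 0"
      "key \<delta> (Some (Inl i)) p = key \<delta> (Some (Inl i)) p' \<longleftrightarrow> inn i"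
      "key \<delta> (Some (Inr i)) p = key \<delta> (Some (Inr i)) p' \<longleftrightarrow> out i" for \<delta> i
      using v by (cases p; cases p'; auto simp: key_def inn_def out_def algebra_simps)+
    define F where "F \<delta> = (\<Sum>t\<in>U \<delta>. if key \<delta> t p = key \<delta> t p' then \<epsilon> \<delta> t else 0)" for \<delta>
    have F\<beta>: "F \<beta> = of_bool (h = 0) + (\<Sum>i\<le>m. if inn i then - 1 else 0)"
      unfolding F_def sum_\<beta> by (simp add: keys \<epsilon>_def cong: if_cong)
    have F\<gamma>: "F \<gamma> = (\<Sum>i<n. if out i then 1 else 0)"
      unfolding F_def sum_\<gamma> by (simp add: keys \<epsilon>_def cong: if_cong)
    have inn_unique: "i = j" if "inn i" "inn j" for i j
    proof (rule ccontr)
      assume "i \<noteq> j"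
      then have "q1 = 0" "q2 = 0"
        using that by (auto simp: inn_def)
      then show False
        using that v0 by (auto simp: inn_def)
    qed
    have out_unique: "i = j" if "out i" "out j" for i j
    proof (rule ccontr)
      assume "i \<noteq> j"
      then have "h = 0" "q1 = 0"
        using that by (auto simp: out_def)
      then show False
        using that v0 by (auto simp: out_def)
    qed
    have sum_inn: "(\<Sum>i\<le>m. if inn i then - 1 else 0) = (- 1 :: int)" if "i \<le> m" "inn i" for i
      using sum_if_unique[of "{..m}" i inn "\<lambda>_. - 1"] inn_unique that by blast
    have sum_out: "(\<Sum>i<n. if out i then 1 else 0) = (1 :: int)" if "i < n" "out i" for i
      using sum_if_unique[of "{..<n}" i out "\<lambda>_. 1"] out_unique that by blast
    have "\<exists>\<delta>\<in>L. F \<beta> = of_bool (\<beta> = \<delta>) \<and> F \<gamma> = of_bool (\<gamma> = \<delta>)"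
    proof (cases "\<exists>i<n. out i")
      case True
      then obtain i where i: "i < n" "out i" by blast
      have "F \<beta> = 0"
      proof (cases "h = 0")
        \<comment> \<open>With \<open>h = 0\<close> an outer plane gives \<open>p = 0\<close>, which
          is the removed plane \<open>inn 0\<close>, so hyperplane and plane cancel for
          \<open>\<beta>\<close>.\<close>
        case True
        then have "inn 0"
          using i(2) by (auto simp: inn_def out_def)
        then show ?thesis
          using True sum_inn[of 0] by (simp add: F\<beta>)
      qed (simp add: F\<beta> inn_def)
      moreover have "F \<gamma> = 1"
        using sum_out[OF i] by (simp add: F\<gamma>)
      ultimately show ?thesis
        using rest by (intro bexI[of _ \<gamma>]) auto
    next
      case False
      then have "F \<gamma> = 0"
        by (auto simp: F\<gamma> intro!: sum.neutral)
      moreover have "F \<beta> = 0 \<or> F \<beta> = 1"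
      proof (cases "\<exists>i\<le>m. inn i")
        case True
        then obtain i where i: "i \<le> m" "inn i" by blast
        then have "h = 0"
          by (simp add: inn_def)
        then show ?thesis
          using sum_inn[OF i] by (simp add: F\<beta>)
      next
        case False
        then have "(\<Sum>i\<le>m. if inn i then - 1 else 0) = (0 :: int)"
          by (intro sum.neutral) auto
        then show ?thesis by (simp add: F\<beta>)
      qed
      moreover have "\<alpha> \<in> L" "\<beta> \<in> L" "\<beta> \<noteq> \<alpha>" "\<gamma> \<noteq> \<alpha>"
        using rel(2) rest by auto
      ultimately show ?thesis
        using rest(2) by (metis of_bool_eq)
    qed
    then show "\<exists>\<delta>\<in>L. \<forall>\<delta>'\<in>L - {\<alpha>}.
        (\<Sum>t\<in>U \<delta>'. if key \<delta>' t p = key \<delta>' t p' then \<epsilon> \<delta>' t else 0) = of_bool (\<delta>' = \<delta>)"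
      unfolding rest by (simp add: F_def)
  qed (auto simp: U_def power_numeral_reduce mult.assoc)
  then show ?thesis by simp
qed

subsection \<open>The equivalences\<close>

lemma bigomega_powr_mono:
  assumes "f \<in> \<Omega>(\<lambda>r::nat. real r powr q)" "p \<le> q"
  shows "f \<in> \<Omega>(\<lambda>r. real r powr p)"
proof -
  have "(\<lambda>r. real r powr q) \<in> \<Omega>(\<lambda>r::nat. real r powr p)"
    using assms(2) by (intro landau_omega.bigI[of 1] eventually_sequentiallyI[of 1]) (auto intro: powr_mono)
  then show ?thesis
    using assms(1) landau_omega.big_trans by blast
qed

text \<open>Growth with any exponent above 1 forces large \<open>N\<close>, hence a relation, so
  each construction gives an equivalence.\<close>

lemma primitive_relation_bigomega_iff:
  fixes L :: "'a::field set"
  assumes "finite L" "card L \<ge> 1" "0 \<notin> L" "p > 1"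
    and "\<And>A. primitive_relation L A \<Longrightarrow> (\<lambda>r. real (N r L)) \<in> \<Omega>(\<lambda>r. real r powr p)"
  shows "(\<exists>A. primitive_relation L A) \<longleftrightarrow> (\<lambda>r. real (N r L)) \<in> \<Omega>(\<lambda>r. real r powr p)"
  using assms primitive_relation_of_N large_N_of_bigomega by metis

lemma large_N_iff_primitive_relation:
  fixes L :: "'a::field set"
  assumes L: "finite L" "card L \<ge> 1" "0 \<notin> L"
  shows "(\<exists>r\<ge>1. N (r - 1) L > card L * r) \<longleftrightarrow> (\<exists>A. primitive_relation L A)"
proof
  assume "\<exists>A. primitive_relation L A"
  then obtain A where "primitive_relation L A" ..
  moreover obtain \<alpha> where "\<alpha> \<in> L"
    using L(2) by fastforce
  ultimately show "\<exists>r\<ge>1. N (r - 1) L > card L * r"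
    by (intro large_N_of_bigomega[OF N_bigomega_three_halves[OF L(1,3)]]) auto
qed (use primitive_relation_of_N[OF L] in blast)

section \<open>Choice of the base element \<open>\<alpha>\<close>\<close>

lemma primitive_relation_pos_element:
  assumes "primitive_relation L A"
  obtains \<beta> where "\<beta> \<in> L" "A \<beta> > 0"
proof -
  have "\<not> (\<forall>\<beta>\<in>L. A \<beta> \<le> 0)"
    using assms sum_nonpos[of L A] by (auto simp: primitive_relation_def)
  then show thesis
    using that by force
qed

text \<open>The base element carries no sign condition; taking the one other than the positive
  \<open>\<beta>\<close> leaves only a positive coefficient.\<close>

lemma N_bigomega_square_card_le_2:
  fixes L :: "'a::field set"
  assumes L: "finite L" "0 \<notin> L" "card L \<le> 2" and rel: "primitive_relation L A"
  shows "(\<lambda>r. real (N r L)) \<in> \<Omega>(\<lambda>r. real r powr 2)"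
proof -
  obtain \<beta> where \<beta>: "\<beta> \<in> L" "A \<beta> > 0"
    using primitive_relation_pos_element[OF rel] .
  have "card (L - {\<beta>}) \<le> 1"
    using L \<beta> by simp
  then consider "L - {\<beta>} = {}" | \<alpha> where "L - {\<beta>} = {\<alpha>}"
    using L(1) by (auto simp: le_Suc_eq card_1_singleton_iff)
  then show ?thesis
  proof cases
    case 1
    then show ?thesis
      by (intro N_bigomega_square[OF L(1,2) rel \<beta>(1)]) blast
  next
    case 2
    then have "\<alpha> \<in> L" "L - {\<alpha>} = {\<beta>}"
      using \<beta>(1) by auto
    then show ?thesis
      using N_bigomega_square[OF L(1,2) rel, of \<alpha>] \<beta>(2) by simp
  qed
qed

text \<open>For three elements, a positive \<open>\<gamma>\<close> and a base
  \<open>\<alpha>\<close> leave only the sign of \<open>A \<beta>\<close> to distinguish.\<close>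

lemma N_bigomega_five_thirds_card_le_3:
  fixes L :: "'a::field set"
  assumes L: "finite L" "0 \<notin> L" "card L \<le> 3" and rel: "primitive_relation L A"
  shows "(\<lambda>r. real (N r L)) \<in> \<Omega>(\<lambda>r. real r powr (5/3))"
proof (cases "card L \<le> 2")
  case True
  then show ?thesis
    using bigomega_powr_mono[OF N_bigomega_square_card_le_2[OF L(1,2) _ rel]] by simp
next
  case False
  obtain \<gamma> where \<gamma>: "\<gamma> \<in> L" "A \<gamma> > 0"
    using primitive_relation_pos_element[OF rel] .
  have "card (L - {\<gamma>}) = 2"
    using L False \<gamma> by simp
  then obtain \<alpha> \<beta> where \<alpha>\<beta>: "L - {\<gamma>} = {\<alpha>, \<beta>}" "\<alpha> \<noteq> \<beta>"
    by (meson card_2_iff)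
  have \<alpha>: "\<alpha> \<in> L" "L - {\<alpha>} = {\<beta>, \<gamma>}" "\<beta> \<noteq> \<gamma>"
    using \<alpha>\<beta> \<gamma>(1) by auto
  show ?thesis
  proof (cases "A \<beta> \<le> 0")
    case True
    then show ?thesis
      using N_bigomega_five_thirds[OF L(1,2) rel \<alpha>] \<gamma>(2) by simp
  next
    case False
    have "0 \<le> A \<delta>" if "\<delta> \<in> L - {\<alpha>}" for \<delta>
      using False \<gamma>(2) that unfolding \<alpha>(2) by auto
    then show ?thesis
      using bigomega_powr_mono[OF N_bigomega_square[OF L(1,2) rel \<alpha>(1)]] by simp
  qed
qed

text \<open>When \<open>\<alpha>\<close> lies strictly between the extreme elements of \<open>L\<close>, the differences
  \<open>\<beta> - \<alpha>\<close> have both signs, so they satisfy a homogeneous relation with positive coefficients,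
  a multiple of which can be added to any primitive relation.\<close>

lemma primitive_relation_nonneg_coeffs:
  fixes L :: "'a::linordered_field set"
  assumes L: "finite L" "L \<subseteq> \<int>" and rel: "primitive_relation L A"
    and \<alpha>: "\<alpha> \<in> L" "\<alpha> < Max L" "Min L < \<alpha>"
  shows "\<exists>A'. primitive_relation L A' \<and> (\<forall>\<beta>\<in>L - {\<alpha>}. A' \<beta> \<ge> 0)"
proof -
  have "\<exists>z. \<beta> - \<alpha> = of_int z" if "\<beta> \<in> L" for \<beta>
    using that L(2) \<alpha>(1) by (meson Ints_cases Ints_diff subsetD)
  then obtain x where x: "\<And>\<beta>. \<beta> \<in> L \<Longrightarrow> \<beta> - \<alpha> = of_int (x \<beta>)"
    by metis
  define P where "P = {\<beta>\<in>L. x \<beta> > 0}"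
  define Q where "Q = {\<beta>\<in>L. x \<beta> < 0}"
  have PQ: "finite P" "finite Q" "P \<inter> Q = {}"
    using L(1) by (auto simp: P_def Q_def)
  have "x \<beta> \<noteq> 0" if "\<beta> \<in> L - {\<alpha>}" for \<beta>
    using x[of \<beta>] that by auto
  moreover have "x \<alpha> = 0"
    using x[OF \<alpha>(1)] by simp
  ultimately have L_split: "L - {\<alpha>} = P \<union> Q"
    by (force simp: P_def Q_def)
  have L_ne: "L \<noteq> {}" using \<alpha>(1) by auto
  have x_sign: "x \<beta> > 0 \<longleftrightarrow> \<alpha> < \<beta>" "x \<beta> < 0 \<longleftrightarrow> \<beta> < \<alpha>" if "\<beta> \<in> L" for \<beta>
    using x[OF that] by (metis diff_gt_0_iff_gt of_int_0_less_iff)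
      (metis x[OF that] diff_less_0_iff_less of_int_less_0_iff)
  have "Max L \<in> P" "Min L \<in> Q"
    using x_sign Max_in[OF L(1) L_ne] Min_in[OF L(1) L_ne] \<alpha>(2,3) by (simp_all add: P_def Q_def)
  define p where "p = (\<Sum>\<beta>\<in>P. x \<beta>)"
  define q where "q = (\<Sum>\<beta>\<in>Q. - x \<beta>)"
  have p: "p > 0"
    unfolding p_def by (rule sum_pos) (use PQ \<open>Max L \<in> P\<close> in \<open>auto simp: P_def\<close>)
  have q: "q > 0"
    unfolding q_def by (rule sum_pos) (use PQ \<open>Min L \<in> Q\<close> in \<open>auto simp: Q_def\<close>)
  \<comment> \<open>The weights \<open>q\<close> on \<open>P\<close> and \<open>p\<close> on
    \<open>Q\<close> balance: \<open>q * p - p * q = 0\<close>.\<close>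
  define B where "B \<beta> = (if \<beta> \<in> P then q else p)" for \<beta>
  have "(\<Sum>\<beta>\<in>L - {\<alpha>}. B \<beta> * x \<beta>) = (\<Sum>\<beta>\<in>P. q * x \<beta>) + (\<Sum>\<beta>\<in>Q. p * x \<beta>)"
    unfolding L_split using PQ by (subst sum.union_disjoint) (auto simp: B_def intro!: arg_cong2[of _ _ _ _ "(+)"] sum.cong)
  also have "\<dots> = 0"
    by (simp add: p_def q_def sum_distrib_left[symmetric] sum_negf)
  finally have B0: "(\<Sum>\<beta>\<in>L - {\<alpha>}. B \<beta> * x \<beta>) = 0" .
  \<comment> \<open>Since \<open>B \<beta> \<ge> 1\<close>, adding \<open>m * B \<beta>\<close>
    outweighs any negative \<open>A \<beta>\<close>.\<close>
  define m where "m = (\<Sum>\<beta>\<in>L. \<bar>A \<beta>\<bar>)"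
  \<comment> \<open>The value at \<open>\<alpha>\<close> restores the sum 1; it does not affect the
    relation written in the differences \<open>\<beta> - \<alpha>\<close>.\<close>
  define A' where "A' = (\<lambda>\<beta>. A \<beta> + m * B \<beta>)(\<alpha> := 1 - (\<Sum>\<beta>\<in>L - {\<alpha>}. A \<beta> + m * B \<beta>))"
  have A'_other: "A' \<beta> = A \<beta> + m * B \<beta>" if "\<beta> \<noteq> \<alpha>" for \<beta>
    using that by (simp add: A'_def)
  have "A' \<beta> \<ge> 0" if "\<beta> \<in> L - {\<alpha>}" for \<beta>
  proof -
    have "\<bar>A \<beta>\<bar> \<le> m"
      unfolding m_def using L(1) that by (intro member_le_sum) auto
    moreover have "m * 1 \<le> m * B \<beta>"
      using p q by (intro mult_left_mono) (auto simp: B_def m_def sum_nonneg)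
    ultimately show ?thesis
      using A'_other that by auto
  qed
  moreover have "primitive_relation L A'"
  proof -
    have sum1: "(\<Sum>\<beta>\<in>L. A' \<beta>) = 1"
      using L(1) \<alpha>(1) A'_other by (simp add: sum.remove) (simp add: A'_def)
    have "(\<Sum>\<beta>\<in>L. of_int (A' \<beta>) * \<beta>) = \<alpha> + (\<Sum>\<beta>\<in>L - {\<alpha>}. of_int (A' \<beta>) * (\<beta> - \<alpha>))"
      by (rule sum_scaled_shift[OF L(1) \<alpha>(1) sum1])
    also have "(\<Sum>\<beta>\<in>L - {\<alpha>}. of_int (A' \<beta>) * (\<beta> - \<alpha>)) =
        (\<Sum>\<beta>\<in>L - {\<alpha>}. of_int (A \<beta>) * (\<beta> - \<alpha>) + of_int m * of_int (B \<beta> * x \<beta>))"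
      using x by (intro sum.cong) (auto simp: A'_other distrib_right mult.assoc)
    also have "\<dots> = (\<Sum>\<beta>\<in>L - {\<alpha>}. of_int (A \<beta>) * (\<beta> - \<alpha>)) + of_int (m * (\<Sum>\<beta>\<in>L - {\<alpha>}. B \<beta> * x \<beta>))"
      by (simp add: sum.distrib sum_distrib_left)
    also have "\<alpha> + \<dots> = 0"
      using primitive_relation_shift[OF L(1) rel \<alpha>(1)] by (simp add: B0)
    finally show ?thesis
      using sum1 by (simp add: primitive_relation_def)
  qed
  ultimately show ?thesis by blast
qed

text \<open>Three or more elements leave one strictly between the extremes to serve as base.\<close>

lemma N_bigomega_square_Ints:
  fixes L :: "'a::linordered_field set"
  assumes L: "finite L" "0 \<notin> L" "L \<subseteq> \<int>" and rel: "primitive_relation L A"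
  shows "(\<lambda>r. real (N r L)) \<in> \<Omega>(\<lambda>r. real r powr 2)"
proof (cases "card L \<le> 2")
  case True
  then show ?thesis
    using N_bigomega_square_card_le_2[OF L(1,2) _ rel] by simp
next
  case False
  have "card (L - {Max L, Min L}) \<ge> card L - card {Max L, Min L}"
    by (intro diff_card_le_card_Diff) simp
  moreover have "card {Max L, Min L} \<le> 2"
    by (simp add: card_insert_if)
  ultimately have "L - {Max L, Min L} \<noteq> {}"
    using False by (metis card.empty diff_is_0_eq le_trans le_zero_eq)
  then obtain \<alpha> where "\<alpha> \<in> L" "\<alpha> \<noteq> Max L" "\<alpha> \<noteq> Min L"
    by blast
  then have \<alpha>: "\<alpha> \<in> L" "\<alpha> < Max L" "Min L < \<alpha>"
    using L(1) by (simp_all add: less_le)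
  then obtain A' where "primitive_relation L A'" "\<forall>\<beta>\<in>L - {\<alpha>}. A' \<beta> \<ge> 0"
    using primitive_relation_nonneg_coeffs[OF L(1,3) rel] by blast
  then show ?thesis
    using N_bigomega_square[OF L(1,2) _ \<alpha>(1), of A'] by blast
qed

theorem theorem3:
  fixes L :: "'a::field set"
  assumes "finite L" and "card L \<ge> 1" and "0 \<notin> L"
  shows "((\<exists>r\<ge>1. N (r - 1) L > card L * r) \<longleftrightarrow> (\<exists>A. primitive_relation L A)) \<and>
    ((\<exists>A. primitive_relation L A) \<longleftrightarrow>
      (\<lambda>r. real (N r L)) \<in> \<Omega>(\<lambda>r. real r powr (3/2))) \<and>
    (card L \<le> 3 \<longrightarrow>
      ((\<exists>A. primitive_relation L A) \<longleftrightarrow>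
        (\<lambda>r. real (N r L)) \<in> \<Omega>(\<lambda>r. real r powr (5/3)))) \<and>
    (card L = 2 \<longrightarrow>
      ((\<exists>A. primitive_relation L A) \<longleftrightarrow>
        (\<lambda>r. real (N r L)) \<in> \<Omega>(\<lambda>r. real r powr 2))) \<and>
    (\<forall>K :: rat set. finite K \<and> card K \<ge> 1 \<and> 0 \<notin> K \<and> K \<subseteq> \<int> \<longrightarrow>
      ((\<exists>r\<ge>1. N (r - 1) K > card K * r) \<longleftrightarrow> (\<exists>A. primitive_relation K A)) \<and>
      ((\<exists>A. primitive_relation K A) \<longleftrightarrow>
        (\<lambda>r. real (N r K)) \<in> \<Omega>(\<lambda>r. real r powr 2)))"
proof -
  obtain \<alpha> where \<alpha>: "\<alpha> \<in> L"
    using assms(2) by fastforce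
  have "(\<exists>A. primitive_relation L A) \<longleftrightarrow> (\<lambda>r. real (N r L)) \<in> \<Omega>(\<lambda>r. real r powr (3/2))"
    by (intro primitive_relation_bigomega_iff[OF assms] N_bigomega_three_halves[OF assms(1,3) _ \<alpha>]) auto
  moreover have "(\<exists>A. primitive_relation L A) \<longleftrightarrow> (\<lambda>r. real (N r L)) \<in> \<Omega>(\<lambda>r. real r powr (5/3))"
    if "card L \<le> 3"
    by (intro primitive_relation_bigomega_iff[OF assms]
        N_bigomega_five_thirds_card_le_3[OF assms(1,3) that]) auto
  moreover have "(\<exists>A. primitive_relation L A) \<longleftrightarrow> (\<lambda>r. real (N r L)) \<in> \<Omega>(\<lambda>r. real r powr 2)"
    if "card L = 2"
    using that by (intro primitive_relation_bigomega_iff[OF assms]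
        N_bigomega_square_card_le_2[OF assms(1,3)]) auto
  moreover have "(\<exists>A. primitive_relation K A) \<longleftrightarrow> (\<lambda>r. real (N r K)) \<in> \<Omega>(\<lambda>r. real r powr 2)"
    if K: "finite K" "card K \<ge> 1" "0 \<notin> K" "K \<subseteq> \<int>" for K :: "rat set"
    by (intro primitive_relation_bigomega_iff[OF K(1-3)] N_bigomega_square_Ints[OF K(1,3,4)]) auto
  ultimately show ?thesis
    using large_N_iff_primitive_relation[OF assms]
      large_N_iff_primitive_relation[where 'a = rat] by blast
qed

end
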